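(* Let $\Gamma=(V,E)$ be a finite simplicial graph and let $\mathcal{G}=\{G_v\}_{v\in V}$ be a collection of groups, each linear over a domain $R$ (not necessarily commutative). Then the graph product $\Gamma\mathcal{G}$ is linear over the polynomial ring $R[\underline{t}]$, for some finite tuple of variables $\underline{t}$.
   Context: A domain is a non-zero unitary ring without zero divisors, not necessarily commutative. A group is linear over a ring $S$ if it is isomorphic to a subgroup of $\mathrm{GL}_n(S)$ for some $n\ge 1$. The variables in $\underline{t}$ are independent polynomial variables commuting with each other and with the elements of $R$. A simplicial graph has no loops and no multiple edges. The graph product is $$\Gamma\mathcal{G}=\langle \ast_{v\in V}G_v \mid [G_v,G_u]=e \text{ for all } \{v,u\}\in E\rangle,$$ i.e. the quotient of the free product of the $G_v$ obtained by making $G_v$ and $G_u$ commute elementwise whenever $\{v,u\}\in E$. No finite generation or cardinality restriction on the groups $G_v$ is assumed. *)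

theory Defs
  imports
    "HOL-Algebra.Algebra"
    "HOL-Library.Poly_Mapping"
    "Jordan_Normal_Form.Matrix"
begin

text \<open>Rings are (not necessarily commutative) rings with \<open>0 \<noteq> 1\<close> given by type classes, so a
  domain is a type of class \<open>ring_1_no_zero_divisors\<close>. The parameter \<open>S\<close> is meant to be a unital
  subring of the type: \<open>UNIV\<close> for the whole type, or \<open>poly_vars k\<close> below.\<close>

definition matrix_ring :: "nat \<Rightarrow> 'a::ring_1 set \<Rightarrow> 'a mat ring" where
  "matrix_ring n S =
     (ring_mat TYPE('a) n ())\<lparr>carrier := {A \<in> carrier_mat n n. elements_mat A \<subseteq> S}\<rparr>"

text \<open>A matrix in \<open>general_linear n S\<close> has a two-sided inverse with entries in \<open>S\<close>.\<close>

definition general_linear :: "nat \<Rightarrow> 'a::ring_1 set \<Rightarrow> 'a mat monoid" where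
  "general_linear n S = units_of (matrix_ring n S)"

definition linear_over :: "'a::ring_1 set \<Rightarrow> ('g, 'm) monoid_scheme \<Rightarrow> bool" where
  "linear_over S G \<longleftrightarrow>
     (\<exists>n\<ge>1. \<exists>H. subgroup H (general_linear n S) \<and> G \<cong> (general_linear n S)\<lparr>carrier := H\<rparr>)"

text \<open>A monomial is a finitely supported exponent function \<open>nat \<Rightarrow>\<^sub>0 nat\<close>, and multiplication on
  \<open>(nat \<Rightarrow>\<^sub>0 nat) \<Rightarrow>\<^sub>0 'a\<close> is convolution. Thus the variables commute with each other and with the
  coefficients, while the coefficients need not commute. \<open>poly_vars k\<close> is the polynomial ring over
  \<open>'a\<close> in the variables with index below \<open>k\<close>.\<close>

definition poly_vars :: "nat \<Rightarrow> ((nat \<Rightarrow>\<^sub>0 nat) \<Rightarrow>\<^sub>0 'a::zero) set" where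
  "poly_vars k = {p. \<forall>m \<in> Poly_Mapping.keys p. Poly_Mapping.keys m \<subseteq> {..<k}}"

lemma poly_vars_0: "0 \<in> poly_vars k"
  by (simp add: poly_vars_def)

lemma poly_vars_1: "(1 :: (nat \<Rightarrow>\<^sub>0 nat) \<Rightarrow>\<^sub>0 'a::ring_1) \<in> poly_vars k"
  by (simp add: poly_vars_def)

lemma poly_vars_uminus:
  "p \<in> poly_vars k \<Longrightarrow> - (p :: (nat \<Rightarrow>\<^sub>0 nat) \<Rightarrow>\<^sub>0 'a::ring_1) \<in> poly_vars k"
  by (simp add: poly_vars_def)

lemma poly_vars_add:
  "p \<in> poly_vars k \<Longrightarrow> q \<in> poly_vars k \<Longrightarrow>
    (p + q :: (nat \<Rightarrow>\<^sub>0 nat) \<Rightarrow>\<^sub>0 'a::ring_1) \<in> poly_vars k"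
  using Poly_Mapping.keys_add[of p q] by (auto simp: poly_vars_def)

lemma poly_vars_mult:
  assumes "p \<in> poly_vars k" "q \<in> poly_vars k"
  shows "(p * q :: (nat \<Rightarrow>\<^sub>0 nat) \<Rightarrow>\<^sub>0 'a::ring_1) \<in> poly_vars k"
  unfolding poly_vars_def
proof (intro CollectI ballI)
  fix m assume "m \<in> Poly_Mapping.keys (p * q)"
  then obtain a b where "m = a + b" "a \<in> Poly_Mapping.keys p" "b \<in> Poly_Mapping.keys q"
    using keys_mult[of p q] by blast
  with assms show "Poly_Mapping.keys m \<subseteq> {..<k}"
    using Poly_Mapping.keys_add[of a b] unfolding poly_vars_def by fast
qed

lemma elements_mat_subset_iff:
  assumes "A \<in> carrier_mat n m"
  shows "elements_mat A \<subseteq> S \<longleftrightarrow> (\<forall>i<n. \<forall>j<m. A $$ (i, j) \<in> S)"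
  using assms by (auto 0 4 dest!: elements_matD intro: elements_matI)

lemma group_general_linear:
  fixes S :: "'a::ring_1 set"
  assumes S: "0 \<in> S" "1 \<in> S"
    "\<And>x y. x \<in> S \<Longrightarrow> y \<in> S \<Longrightarrow> x + y \<in> S" "\<And>x y. x \<in> S \<Longrightarrow> y \<in> S \<Longrightarrow> x * y \<in> S"
  shows "group (general_linear n S)"
proof -
  have sum_closed: "sum f I \<in> S" if "\<And>i. i \<in> I \<Longrightarrow> f i \<in> S" for f :: "nat \<Rightarrow> 'a" and I
    using that by (induction I rule: infinite_finite_induct) (auto intro: S)
  have "monoid (matrix_ring n S)"
  proof
    fix A B
    assume "A \<in> carrier (matrix_ring n S)" "B \<in> carrier (matrix_ring n S)"
    then have AB: "A \<in> carrier_mat n n" "B \<in> carrier_mat n n"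
      "elements_mat A \<subseteq> S" "elements_mat B \<subseteq> S"
      by (auto simp: matrix_ring_def)
    then have "elements_mat (A * B) \<subseteq> S"
      unfolding elements_mat_subset_iff[OF mult_carrier_mat[OF AB(1,2)]]
      by (auto simp: elements_mat_subset_iff[of A n n] elements_mat_subset_iff[of B n n]
          scalar_prod_def intro!: sum_closed S)
    with AB show "A \<otimes>\<^bsub>matrix_ring n S\<^esub> B \<in> carrier (matrix_ring n S)"
      by (simp add: matrix_ring_def ring_mat_def)
  next
    show "\<one>\<^bsub>matrix_ring n S\<^esub> \<in> carrier (matrix_ring n S)"
      by (auto simp: matrix_ring_def ring_mat_def elements_mat_subset_iff[of _ n n] S)
  qed (auto simp: matrix_ring_def ring_mat_def)
  then show ?thesis
    unfolding general_linear_def by (rule monoid.units_group)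
qed

lemma group_general_linear_UNIV: "group (general_linear n UNIV)"
  by (rule group_general_linear) auto

lemma group_general_linear_poly_vars:
  "group (general_linear n (poly_vars k :: ((nat \<Rightarrow>\<^sub>0 nat) \<Rightarrow>\<^sub>0 'a::ring_1) set))"
  by (rule group_general_linear) (auto intro: poly_vars_0 poly_vars_1 poly_vars_add poly_vars_mult)

text \<open>The free product of the groups \<open>G v\<close>, \<open>v \<in> V\<close>: words in letters \<open>(v, g)\<close> with
  \<open>g \<in> carrier (G v)\<close>, modulo the congruence that deletes identity letters and multiplies adjacent
  letters of the same group.\<close>

definition fp_words :: "'v set \<Rightarrow> ('v \<Rightarrow> ('g, 'm) monoid_scheme) \<Rightarrow> ('v \<times> 'g) list set" where
  "fp_words V G = lists (SIGMA v:V. carrier (G v))"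

inductive_set fp_rel ::
  "'v set \<Rightarrow> ('v \<Rightarrow> ('g, 'm) monoid_scheme) \<Rightarrow> (('v \<times> 'g) list \<times> ('v \<times> 'g) list) set"
  for V :: "'v set" and G :: "'v \<Rightarrow> ('g, 'm) monoid_scheme" where
  refl: "w \<in> fp_words V G \<Longrightarrow> (w, w) \<in> fp_rel V G"
| sym: "(w, w') \<in> fp_rel V G \<Longrightarrow> (w', w) \<in> fp_rel V G"
| trans: "(w, w') \<in> fp_rel V G \<Longrightarrow> (w', w'') \<in> fp_rel V G \<Longrightarrow> (w, w'') \<in> fp_rel V G"
| one: "a \<in> fp_words V G \<Longrightarrow> b \<in> fp_words V G \<Longrightarrow> v \<in> V \<Longrightarrow>
    (a @ [(v, \<one>\<^bsub>G v\<^esub>)] @ b, a @ b) \<in> fp_rel V G"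
| mult: "a \<in> fp_words V G \<Longrightarrow> b \<in> fp_words V G \<Longrightarrow> v \<in> V \<Longrightarrow>
    g \<in> carrier (G v) \<Longrightarrow> h \<in> carrier (G v) \<Longrightarrow>
    (a @ [(v, g), (v, h)] @ b, a @ [(v, g \<otimes>\<^bsub>G v\<^esub> h)] @ b) \<in> fp_rel V G"

definition free_product ::
  "'v set \<Rightarrow> ('v \<Rightarrow> ('g, 'm) monoid_scheme) \<Rightarrow> ('v \<times> 'g) list set monoid" where
  "free_product V G =
     \<lparr>carrier = fp_words V G // fp_rel V G,
      monoid.mult = (\<lambda>A B. \<Union>u\<in>A. \<Union>w\<in>B. fp_rel V G `` {u @ w}),
      one = fp_rel V G `` {[]}\<rparr>"

definition fp_incl ::
  "'v set \<Rightarrow> ('v \<Rightarrow> ('g, 'm) monoid_scheme) \<Rightarrow> 'v \<Rightarrow> 'g \<Rightarrow> ('v \<times> 'g) list set" where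
  "fp_incl V G v g = fp_rel V G `` {[(v, g)]}"

definition simplicial_graph :: "'v set \<Rightarrow> 'v set set \<Rightarrow> bool" where
  "simplicial_graph V E \<longleftrightarrow> (\<forall>e\<in>E. e \<subseteq> V \<and> card e = 2)"

definition normal_closure :: "('g, 'm) monoid_scheme \<Rightarrow> 'g set \<Rightarrow> 'g set" where
  "normal_closure F S = \<Inter>{N. N \<lhd> F \<and> S \<subseteq> N}"

definition commutator :: "('g, 'm) monoid_scheme \<Rightarrow> 'g \<Rightarrow> 'g \<Rightarrow> 'g" where
  "commutator F x y = x \<otimes>\<^bsub>F\<^esub> y \<otimes>\<^bsub>F\<^esub> inv\<^bsub>F\<^esub> x \<otimes>\<^bsub>F\<^esub> inv\<^bsub>F\<^esub> y"

definition graph_relators ::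
  "'v set \<Rightarrow> 'v set set \<Rightarrow> ('v \<Rightarrow> ('g, 'm) monoid_scheme) \<Rightarrow> ('v \<times> 'g) list set set" where
  "graph_relators V E G =
     {commutator (free_product V G) (fp_incl V G v g) (fp_incl V G u h) | v u g h.
        {v, u} \<in> E \<and> g \<in> carrier (G v) \<and> h \<in> carrier (G u)}"

definition graph_product ::
  "'v set \<Rightarrow> 'v set set \<Rightarrow> ('v \<Rightarrow> ('g, 'm) monoid_scheme) \<Rightarrow> ('v \<times> 'g) list set set monoid" where
  "graph_product V E G =
     free_product V G Mod normal_closure (free_product V G) (graph_relators V E G)"

lemma fp_words_Nil: "[] \<in> fp_words V G"
  by (simp add: fp_words_def)

lemma fp_words_append_iff: "u @ w \<in> fp_words V G \<longleftrightarrow> u \<in> fp_words V G \<and> w \<in> fp_words V G"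
  by (auto simp: fp_words_def)

lemma fp_words_Cons_iff:
  "(v, g) # w \<in> fp_words V G \<longleftrightarrow> v \<in> V \<and> g \<in> carrier (G v) \<and> w \<in> fp_words V G"
  by (auto simp: fp_words_def)

lemmas fp_words_simps = fp_words_Nil fp_words_append_iff fp_words_Cons_iff

locale group_family =
  fixes V :: "'v set" and G :: "'v \<Rightarrow> ('g, 'm) monoid_scheme"
  assumes groups: "v \<in> V \<Longrightarrow> group (G v)"
begin

lemma fp_rel_words: "(u, w) \<in> fp_rel V G \<Longrightarrow> u \<in> fp_words V G \<and> w \<in> fp_words V G"
proof (induction rule: fp_rel.induct)
  case (one a b v)
  with groups[of v] show ?case by (auto simp: fp_words_simps group.is_monoid monoid.one_closed)
next
  case (mult a b v g h)
  with groups[of v] show ?case by (auto simp: fp_words_simps group.is_monoid monoid.m_closed)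
qed auto

lemma equiv_fp_rel: "equiv (fp_words V G) (fp_rel V G)"
proof (rule equivI)
  show "fp_rel V G \<subseteq> fp_words V G \<times> fp_words V G"
    using fp_rel_words by auto
  show "refl_on (fp_words V G) (fp_rel V G)"
    by (auto simp: refl_on_def intro: fp_rel.refl)
  show "sym (fp_rel V G)"
    by (auto simp: sym_def intro: fp_rel.sym)
  show "trans (fp_rel V G)"
    by (auto simp: trans_def intro: fp_rel.trans)
qed

lemma fp_rel_context:
  "(u, w) \<in> fp_rel V G \<Longrightarrow> c \<in> fp_words V G \<Longrightarrow> d \<in> fp_words V G \<Longrightarrow>
    (c @ u @ d, c @ w @ d) \<in> fp_rel V G"
proof (induction rule: fp_rel.induct)
  case (refl w)
  then show ?case
    by (intro fp_rel.refl) (simp add: fp_words_append_iff)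
next
  case (sym w w')
  show ?case
    by (rule fp_rel.sym[OF sym.IH]) (rule sym.prems)+
next
  case (trans w w' w'')
  show ?case
    by (rule fp_rel.trans[OF trans.IH(1) trans.IH(2)]) (rule trans.prems)+
next
  case (one a b v)
  then show ?case
    using fp_rel.one[of "c @ a" V G "b @ d" v] by (simp add: fp_words_append_iff)
next
  case (mult a b v g h)
  then show ?case
    using fp_rel.mult[of "c @ a" V G "b @ d" v g h] by (simp add: fp_words_append_iff)
qed

lemma fp_rel_append:
  assumes "(u, u') \<in> fp_rel V G" "(w, w') \<in> fp_rel V G"
  shows "(u @ w, u' @ w') \<in> fp_rel V G"
proof (rule fp_rel.trans)
  show "(u @ w, u' @ w) \<in> fp_rel V G"
    using fp_rel_context[of u u' "[]" w] assms fp_rel_words[of w w'] by (simp add: fp_words_Nil)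
  show "(u' @ w, u' @ w') \<in> fp_rel V G"
    using fp_rel_context[of w w' u' "[]"] assms fp_rel_words[of u u'] by (simp add: fp_words_Nil)
qed

lemma free_product_mult:
  assumes "u \<in> fp_words V G" "w \<in> fp_words V G"
  shows "fp_rel V G `` {u} \<otimes>\<^bsub>free_product V G\<^esub> fp_rel V G `` {w} = fp_rel V G `` {u @ w}"
proof -
  have "fp_rel V G `` {x @ y} = fp_rel V G `` {u @ w}"
    if "(u, x) \<in> fp_rel V G" "(w, y) \<in> fp_rel V G" for x y
    using equiv_class_eq[OF equiv_fp_rel fp_rel_append[OF that]] by simp
  moreover have "(u, u) \<in> fp_rel V G" "(w, w) \<in> fp_rel V G"
    using assms by (auto intro: fp_rel.refl)
  ultimately have "(\<Union>x\<in>fp_rel V G `` {u}. \<Union>y\<in>fp_rel V G `` {w}. fp_rel V G `` {x @ y}) =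
      fp_rel V G `` {u @ w}"
    by blast
  then show ?thesis
    by (simp add: free_product_def)
qed

lemma free_product_carrierI: "w \<in> fp_words V G \<Longrightarrow> fp_rel V G `` {w} \<in> carrier (free_product V G)"
  by (simp add: free_product_def quotientI)

lemma free_product_carrierE:
  assumes "x \<in> carrier (free_product V G)"
  obtains w where "w \<in> fp_words V G" "x = fp_rel V G `` {w}"
  using assms by (auto simp: free_product_def elim: quotientE)

lemma word_inverse_ex:
  "w \<in> fp_words V G \<Longrightarrow> \<exists>w' \<in> fp_words V G. (w' @ w, []) \<in> fp_rel V G"
proof (induction w)
  case Nil
  then show ?case by (auto intro!: bexI[of _ "[]"] fp_rel.refl)
next
  case (Cons x w)
  obtain v g where x: "x = (v, g)" by (cases x)
  with Cons.prems have v: "v \<in> V" "g \<in> carrier (G v)" and w: "w \<in> fp_words V G"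
    by (auto simp: fp_words_Cons_iff)
  interpret Gv: group "G v" using groups v by blast
  from Cons.IH w obtain w' where w': "w' \<in> fp_words V G" "(w' @ w, []) \<in> fp_rel V G" by blast
  have "(w' @ [(v, inv\<^bsub>G v\<^esub> g), (v, g)] @ w, w' @ [(v, inv\<^bsub>G v\<^esub> g \<otimes>\<^bsub>G v\<^esub> g)] @ w) \<in> fp_rel V G"
    using v w w' by (intro fp_rel.mult) auto
  moreover have "(w' @ [(v, \<one>\<^bsub>G v\<^esub>)] @ w, w' @ w) \<in> fp_rel V G"
    using v w w' by (intro fp_rel.one) auto
  ultimately have "((w' @ [(v, inv\<^bsub>G v\<^esub> g)]) @ x # w, []) \<in> fp_rel V G"
    using w'(2) v x by (auto intro: fp_rel.trans)
  then show ?case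
    using w'(1) v by (intro bexI[of _ "w' @ [(v, inv\<^bsub>G v\<^esub> g)]"]) (auto simp: fp_words_simps)
qed

lemma group_free_product: "group (free_product V G)"
proof (rule groupI)
  show "\<one>\<^bsub>free_product V G\<^esub> \<in> carrier (free_product V G)"
    by (simp add: free_product_def quotientI fp_words_Nil)
  have one: "\<one>\<^bsub>free_product V G\<^esub> = fp_rel V G `` {[]}"
    by (simp add: free_product_def)
  fix x assume x: "x \<in> carrier (free_product V G)"
  then obtain u where u: "u \<in> fp_words V G" "x = fp_rel V G `` {u}"
    by (rule free_product_carrierE)
  show "\<one>\<^bsub>free_product V G\<^esub> \<otimes>\<^bsub>free_product V G\<^esub> x = x"
    by (simp add: one u free_product_mult fp_words_Nil)
  from word_inverse_ex[OF u(1)] obtain u' where u': "u' \<in> fp_words V G" "(u' @ u, []) \<in> fp_rel V G"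
    by blast
  show "\<exists>y\<in>carrier (free_product V G). y \<otimes>\<^bsub>free_product V G\<^esub> x = \<one>\<^bsub>free_product V G\<^esub>"
  proof (rule bexI)
    show "fp_rel V G `` {u'} \<otimes>\<^bsub>free_product V G\<^esub> x = \<one>\<^bsub>free_product V G\<^esub>"
      using equiv_class_eq[OF equiv_fp_rel u'(2)] by (simp add: one u u' free_product_mult)
  qed (simp add: u' free_product_carrierI)
  fix y assume "y \<in> carrier (free_product V G)"
  then obtain w where w: "w \<in> fp_words V G" "y = fp_rel V G `` {w}"
    by (rule free_product_carrierE)
  show "x \<otimes>\<^bsub>free_product V G\<^esub> y \<in> carrier (free_product V G)"
    by (simp add: u w free_product_mult free_product_carrierI fp_words_append_iff)
  fix z assume "z \<in> carrier (free_product V G)"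
  then obtain s where s: "s \<in> fp_words V G" "z = fp_rel V G `` {s}"
    by (rule free_product_carrierE)
  show "x \<otimes>\<^bsub>free_product V G\<^esub> y \<otimes>\<^bsub>free_product V G\<^esub> z =
      x \<otimes>\<^bsub>free_product V G\<^esub> (y \<otimes>\<^bsub>free_product V G\<^esub> z)"
    by (simp add: u w s free_product_mult fp_words_append_iff)
qed

lemma fp_incl_hom:
  assumes "v \<in> V"
  shows "fp_incl V G v \<in> hom (G v) (free_product V G)"
proof (rule homI)
  fix g assume g: "g \<in> carrier (G v)"
  with assms show "fp_incl V G v g \<in> carrier (free_product V G)"
    by (simp add: fp_incl_def free_product_carrierI fp_words_simps)
  fix h assume h: "h \<in> carrier (G v)"
  have "([(v, g), (v, h)], [(v, g \<otimes>\<^bsub>G v\<^esub> h)]) \<in> fp_rel V G"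
    using fp_rel.mult[of "[]" V G "[]" v g h] assms g h by (simp add: fp_words_Nil)
  from equiv_class_eq[OF equiv_fp_rel this] assms g h
  show "fp_incl V G v (g \<otimes>\<^bsub>G v\<^esub> h) = fp_incl V G v g \<otimes>\<^bsub>free_product V G\<^esub> fp_incl V G v h"
    by (simp add: fp_incl_def free_product_mult fp_words_simps)
qed

end

lemma (in group) normal_normal_closure:
  assumes "S \<subseteq> carrier G"
  shows "normal_closure G S \<lhd> G"
proof (rule normal_invI)
  have "carrier G \<lhd> G"
    by (rule normal_invI[OF subgroup_self]) simp
  with assms have ne: "{N. N \<lhd> G \<and> S \<subseteq> N} \<noteq> {}" by blast
  show "subgroup (normal_closure G S) G"
    unfolding normal_closure_def
    by (rule subgroups_Inter[OF _ ne]) (auto intro: normal_imp_subgroup)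
  show "x \<otimes> h \<otimes> inv x \<in> normal_closure G S" if "x \<in> carrier G" "h \<in> normal_closure G S" for x h
    using that unfolding normal_closure_def by (auto intro: normal.inv_op_closed2)
qed

context group_family
begin

lemma graph_relators_carrier:
  assumes "simplicial_graph V E"
  shows "graph_relators V E G \<subseteq> carrier (free_product V G)"
proof -
  interpret F: group "free_product V G" by (rule group_free_product)
  have "v \<in> V \<and> u \<in> V" if "{v, u} \<in> E" for v u
    using assms that by (auto simp: simplicial_graph_def)
  then show ?thesis
    unfolding graph_relators_def commutator_def
    by (auto intro!: F.m_closed F.inv_closed hom_in_carrier[OF fp_incl_hom])
qed

lemma group_graph_product:
  assumes "simplicial_graph V E"
  shows "group (graph_product V E G)"
  unfolding graph_product_def
  by (intro normal.factorgroup_is_group group.normal_normal_closure group_free_product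
      graph_relators_carrier assms)

end

end

theory Submission
  imports Defs
begin

text \<open>Let \<open>n\<^sub>v\<close> be the degree of the given representation of \<open>G\<^sub>v\<close>. Over \<open>R[(s\<^sub>v), y]\<close> take the
  column vectors \<open>f\<close> with coordinates \<open>f(\<emptyset>)\<close> and \<open>f(v, l)\<close>, \<open>l < n\<^sub>v\<close>, and put
  \<open>\<sigma>\<^sub>v f = \<Sum>\<^sub>l y\<^sup>l\<^sup>n f(v, l)\<close> with \<open>n = n\<^sub>v\<close> and \<open>\<tau>\<^sub>v f = f(\<emptyset>) + \<Sum>\<^sub>u \<sigma>\<^sub>u f\<close>, the sum being over the
  vertices \<open>u \<noteq> v\<close> not adjacent to \<open>v\<close>. An element of \<open>G\<^sub>v\<close> acts through its matrix on the
  shifted coordinates \<open>f(v, l) + s\<^sub>v y\<^sup>l \<tau>\<^sub>v f\<close> and fixes all coordinates not belonging to \<open>v\<close>.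
  As \<open>\<tau>\<^sub>v\<close> does not involve the coordinates of \<open>v\<close> or of its neighbours, this is an action of
  \<open>G\<^sub>v\<close>, and actions of adjacent vertices commute.

  For faithfulness let a reduced word act on the basis vector of \<open>\<emptyset>\<close>. With respect to a
  lexicographic order on the monomials in the \<open>s\<^sub>v\<close>, the letter at position \<open>j\<close> makes \<open>\<sigma>\<^sub>v f\<close> a
  polynomial whose leading monomial is the largest weight \<open>h(j)\<close> of a chain of positions ending at
  \<open>j\<close>, consecutive letters of a chain being distinct and not adjacent. Different positions have
  different heights \<open>h\<close>, so the leading terms of the summands of \<open>\<tau>\<^sub>v f\<close> never cancel, and the
  powers of \<open>y\<close> keep the leading coefficient \<open>\<Sum>\<^sub>l\<^sub>k y\<^sup>l\<^sup>n\<^sup>+\<^sup>k (A - 1)\<^sub>l\<^sub>k\<close> contributed by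
  a letter with matrix \<open>A \<noteq> 1\<close> from vanishing.\<close>

section \<open>Leading monomials\<close>

abbreviation expo :: "nat \<Rightarrow> nat \<Rightarrow> (nat \<Rightarrow>\<^sub>0 nat)" where
  "expo i k \<equiv> Poly_Mapping.single i k"

lemma poly_mapping_less_iff:
  fixes f g :: "'b::linorder \<Rightarrow>\<^sub>0 nat"
  shows "f < g \<longleftrightarrow> (\<exists>k. Poly_Mapping.lookup f k < Poly_Mapping.lookup g k \<and>
    (\<forall>k'<k. Poly_Mapping.lookup f k' = Poly_Mapping.lookup g k'))"
  by transfer (auto simp: less_fun_def)

lemma poly_mapping_nat_ge_0:
  fixes f :: "nat \<Rightarrow>\<^sub>0 nat"
  shows "0 \<le> f"
proof (rule ccontr)
  assume "\<not> 0 \<le> f"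
  then have "f < 0" by simp
  then show False by (auto simp: poly_mapping_less_iff)
qed

text \<open>The first index at which \<open>f\<close> and \<open>g\<close> differ is at most
  \<open>w\<close>, and there the assumptions leave only the strict inequality in favour of
  \<open>g\<close>.\<close>

lemma poly_mapping_less_if_lookup_le:
  fixes f g :: "nat \<Rightarrow>\<^sub>0 nat"
  assumes "\<And>u. u < w \<Longrightarrow> Poly_Mapping.lookup f u \<le> Poly_Mapping.lookup g u"
    and "Poly_Mapping.lookup f w < Poly_Mapping.lookup g w"
  shows "f < g"
proof -
  let ?P = "\<lambda>u. Poly_Mapping.lookup f u \<noteq> Poly_Mapping.lookup g u"
  define k where "k = (LEAST u. ?P u)"
  have w: "?P w" using assms(2) by simp
  have k: "?P k" unfolding k_def using w by (rule LeastI)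
  have kw: "k \<le> w" unfolding k_def using w by (rule Least_le)
  have "\<not> ?P u" if "u < k" for u using that unfolding k_def by (rule not_less_Least)
  moreover have "Poly_Mapping.lookup f k < Poly_Mapping.lookup g k"
    using k kw assms by (cases "k = w") (auto simp: order.strict_iff_order)
  ultimately show ?thesis unfolding poly_mapping_less_iff by blast
qed

text \<open>The index deciding \<open>a < b\<close> is a key of \<open>b\<close>, hence below
  \<open>r\<close>; the powers of the variable of index \<open>r\<close> come later in the
  lexicographic comparison and cannot reverse it.\<close>

lemma less_expo_shift:
  fixes a b :: "nat \<Rightarrow>\<^sub>0 nat"
  assumes "a < b" "Poly_Mapping.keys a \<subseteq> {..<r}" "Poly_Mapping.keys b \<subseteq> {..<r}"
  shows "a + expo r e < b + expo r e'"
proof -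
  obtain k where k: "Poly_Mapping.lookup a k < Poly_Mapping.lookup b k"
    "\<forall>k'<k. Poly_Mapping.lookup a k' = Poly_Mapping.lookup b k'"
    using assms(1) unfolding poly_mapping_less_iff by blast
  have "k \<in> Poly_Mapping.keys b" using k(1) by (auto simp: in_keys_iff)
  with assms have "k < r" by auto
  then have "Poly_Mapping.lookup (expo r e) u = 0" if "u \<le> k" for u e
    using that by (simp add: lookup_single)
  with k show ?thesis
    unfolding poly_mapping_less_iff by (intro exI[of _ k]) (simp add: lookup_add)
qed

type_synonym 'a mpoly = "(nat \<Rightarrow>\<^sub>0 nat) \<Rightarrow>\<^sub>0 'a"

text \<open>The variable \<open>y\<close> of index \<open>r\<close> has the lowest priority in the lexicographic order, so the next two
  notions describe degrees in the other variables only: \<open>p\<close> is of degree at most, respectively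
  exactly, \<open>a\<close>.\<close>

definition dominated :: "nat \<Rightarrow> (nat \<Rightarrow>\<^sub>0 nat) \<Rightarrow> 'a::zero mpoly \<Rightarrow> bool" where
  "dominated r a p \<longleftrightarrow> (\<forall>m \<in> Poly_Mapping.keys p. \<exists>e. m \<le> a + expo r e)"

definition leads :: "nat \<Rightarrow> (nat \<Rightarrow>\<^sub>0 nat) \<Rightarrow> 'a::comm_monoid_add mpoly \<Rightarrow> bool" where
  "leads r a p \<longleftrightarrow> (\<exists>e c q. c \<noteq> 0 \<and> p = Poly_Mapping.single (a + expo r e) c + q \<and>
     (\<forall>m \<in> Poly_Mapping.keys q. m < a + expo r e))"

lemma leads_dominated: "leads r a p \<Longrightarrow> dominated r a p"
  using Poly_Mapping.keys_add unfolding leads_def dominated_def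
  by (fastforce split: if_splits)

lemma leads_nonzero: 
  assumes "leads r a p"
  shows "p \<noteq> 0"
proof -
  obtain e c q where c: "c \<noteq> 0" and p: "p = Poly_Mapping.single (a + expo r e) c + q"
    and q: "\<forall>m \<in> Poly_Mapping.keys q. m < a + expo r e"
    using assms unfolding leads_def by blast
  have "Poly_Mapping.lookup q (a + expo r e) = 0"
    using q by (metis in_keys_iff less_irrefl)
  then have "Poly_Mapping.lookup p (a + expo r e) = c"
    by (simp add: p lookup_add)
  with c show ?thesis by auto
qed

lemma dominated_0 [simp]: "dominated r a 0"
  by (simp add: dominated_def)

lemma dominated_add: "dominated r a p \<Longrightarrow> dominated r a q \<Longrightarrow> dominated r a (p + q)"
  using Poly_Mapping.keys_add[of p q] by (auto simp: dominated_def)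

lemma dominated_sum: "(\<And>i. i \<in> I \<Longrightarrow> dominated r a (p i)) \<Longrightarrow> dominated r a (sum p I)"
  by (induction I rule: infinite_finite_induct) (auto intro: dominated_add)

lemma dominated_mono: "dominated r a p \<Longrightarrow> a \<le> b \<Longrightarrow> dominated r b p"
  unfolding dominated_def by (meson add_right_mono order_trans)

lemma dominated_mult:
  fixes p q :: "'a::semiring_0 mpoly"
  assumes "dominated r a p" "dominated r b q"
  shows "dominated r (a + b) (p * q)"
  unfolding dominated_def
proof
  fix m assume "m \<in> Poly_Mapping.keys (p * q)"
  then obtain s t where m: "m = s + t" "s \<in> Poly_Mapping.keys p" "t \<in> Poly_Mapping.keys q"
    using keys_mult[of p q] by blast
  then obtain e e' where "s \<le> a + expo r e" "t \<le> b + expo r e'"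
    using assms by (meson dominated_def)
  then have "m \<le> a + b + expo r (e + e')"
    using add_mono m(1) by (fastforce simp: single_add ac_simps)
  then show "\<exists>e. m \<le> a + b + expo r e" ..
qed

text \<open>By \<open>less_expo_shift\<close>, every monomial of \<open>q\<close> stays below the
  leading monomial of \<open>p\<close>, whatever powers of the variable of index \<open>r\<close>
  occur.\<close>

lemma leads_add:
  assumes "leads r a p" "dominated r b q" "b < a"
    and "Poly_Mapping.keys a \<subseteq> {..<r}" "Poly_Mapping.keys b \<subseteq> {..<r}"
  shows "leads r a (p + q)"
proof -
  obtain e c p' where c: "c \<noteq> 0" and p: "p = Poly_Mapping.single (a + expo r e) c + p'"
    and p': "\<forall>m \<in> Poly_Mapping.keys p'. m < a + expo r e"
    using assms unfolding leads_def by blast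
  have "m < a + expo r e" if m: "m \<in> Poly_Mapping.keys q" for m
  proof -
    obtain e' where "m \<le> b + expo r e'" using m assms(2) by (auto simp: dominated_def)
    also have "\<dots> < a + expo r e" using assms by (intro less_expo_shift)
    finally show ?thesis .
  qed
  with p' have "\<forall>m \<in> Poly_Mapping.keys (p' + q). m < a + expo r e"
    using Poly_Mapping.keys_add[of p' q] by blast
  with c show ?thesis
    unfolding leads_def p by (metis add.assoc)
qed

text \<open>Since the leading degrees differ, only one summand attains the largest; the others
  together are dominated by the second largest.\<close>

lemma leads_sum:
  assumes "finite I" "I \<noteq> {}" "\<And>i. i \<in> I \<Longrightarrow> leads r (a i) (p i)" "inj_on a I"
    and "\<And>i. i \<in> I \<Longrightarrow> Poly_Mapping.keys (a i) \<subseteq> {..<r}"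
  shows "leads r (Max (a ` I)) (sum p I)"
proof -
  have "Max (a ` I) \<in> a ` I" using assms by (intro Max_in) auto
  then obtain i where i: "i \<in> I" and ai: "Max (a ` I) = a i" by auto
  show ?thesis
  proof (cases "I = {i}")
    case True
    with i assms show ?thesis by simp
  next
    case False
    define J where "J = I - {i}"
    have J: "finite J" "J \<noteq> {}" "J \<subseteq> I" "i \<notin> J" using assms False i unfolding J_def by auto
    have less: "a j < a i" if "j \<in> J" for j
      using that J assms i ai[symmetric]
      by (metis (no_types) Max_ge finite_imageI imageI inj_on_contraD
          order.not_eq_order_implies_strict subsetD)
    have "Max (a ` J) \<in> a ` J" using J by (intro Max_in) auto
    then obtain k where k: "k \<in> J" and ak: "Max (a ` J) = a k" by auto
    have dom: "dominated r (a k) (sum p J)"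
    proof (intro dominated_sum)
      fix j assume "j \<in> J"
      then have "leads r (a j) (p j)" "a j \<le> a k"
        using assms(3) J ak[symmetric] by (auto intro!: Max_ge)
      then show "dominated r (a k) (p j)" by (meson leads_dominated dominated_mono)
    qed
    have "leads r (a i) (p i + sum p J)"
    proof (rule leads_add)
      show "a k < a i" by (rule less[OF k])
      show "Poly_Mapping.keys (a k) \<subseteq> {..<r}" using k J assms(5) by blast
    qed (use i assms dom in auto)
    then show ?thesis unfolding ai J_def by (simp add: sum.remove[OF assms(1) i])
  qed
qed

lemma keys_mult_less:
  fixes p q :: "(nat \<Rightarrow>\<^sub>0 nat) \<Rightarrow>\<^sub>0 'a::semiring_0"
  assumes "m \<in> Poly_Mapping.keys (p * q)"
    and "Poly_Mapping.keys p \<subseteq> {..a}" "Poly_Mapping.keys q \<subseteq> {..<b}"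
  shows "m < a + b"
proof -
  obtain s t where "m = s + t" "s \<in> Poly_Mapping.keys p" "t \<in> Poly_Mapping.keys q"
    using keys_mult[of p q] assms(1) by blast
  with assms(2,3) show ?thesis by (auto intro!: add_le_less_mono)
qed

lemma keys_mult_less':
  fixes p q :: "(nat \<Rightarrow>\<^sub>0 nat) \<Rightarrow>\<^sub>0 'a::semiring_0"
  assumes "m \<in> Poly_Mapping.keys (p * q)"
    and "Poly_Mapping.keys p \<subseteq> {..<a}" "Poly_Mapping.keys q \<subseteq> {..b}"
  shows "m < a + b"
proof -
  obtain s t where "m = s + t" "s \<in> Poly_Mapping.keys p" "t \<in> Poly_Mapping.keys q"
    using keys_mult[of p q] assms(1) by blast
  with assms(2,3) show ?thesis by (auto intro!: add_less_le_mono)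
qed

text \<open>The leading terms multiply to a term with coefficient \<open>c * d\<close>, nonzero in
  the absence of zero divisors. The order is compatible with addition of exponents, so all other
  products of terms are smaller.\<close>

lemma leads_mult:
  fixes p q :: "'a::semiring_no_zero_divisors mpoly"
  assumes "leads r a p" "leads r b q"
  shows "leads r (a + b) (p * q)"
proof -
  obtain e c p' where c: "c \<noteq> 0" and p: "p = Poly_Mapping.single (a + expo r e) c + p'"
    and p': "\<forall>m \<in> Poly_Mapping.keys p'. m < a + expo r e"
    using assms unfolding leads_def by blast
  obtain e' d q' where d: "d \<noteq> 0" and q: "q = Poly_Mapping.single (b + expo r e') d + q'"
    and q': "\<forall>m \<in> Poly_Mapping.keys q'. m < b + expo r e'"
    using assms unfolding leads_def by blast
  let ?A = "Poly_Mapping.single (a + expo r e) c" and ?B = "Poly_Mapping.single (b + expo r e') d"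
  have sum: "a + expo r e + (b + expo r e') = a + b + expo r (e + e')"
    by (simp add: single_add ac_simps)
  have "p * q = ?A * ?B + (?A * q' + p' * ?B + p' * q')"
    by (simp add: p q algebra_simps)
  moreover have "?A * ?B = Poly_Mapping.single (a + b + expo r (e + e')) (c * d)"
    by (simp add: mult_single sum)
  moreover have "m < a + b + expo r (e + e')" if "m \<in> Poly_Mapping.keys (?A * q' + p' * ?B + p' * q')" for m
  proof -
    have "m \<in> Poly_Mapping.keys (?A * q') \<union> Poly_Mapping.keys (p' * ?B) \<union> Poly_Mapping.keys (p' * q')"
      using subsetD[OF Poly_Mapping.keys_add that]
        subsetD[OF Poly_Mapping.keys_add[of "?A * q'" "p' * ?B"]] by (elim UnE) auto
    moreover have A: "Poly_Mapping.keys ?A \<subseteq> {..a + expo r e}" "Poly_Mapping.keys ?B \<subseteq> {..b + expo r e'}"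
      "Poly_Mapping.keys p' \<subseteq> {..<a + expo r e}" "Poly_Mapping.keys q' \<subseteq> {..<b + expo r e'}"
      using p' q' by auto
    moreover from A(3) have "Poly_Mapping.keys p' \<subseteq> {..a + expo r e}" by auto
    ultimately show ?thesis
      unfolding sum[symmetric]
      by (elim UnE) (erule keys_mult_less keys_mult_less', assumption, assumption)+
  qed
  ultimately show ?thesis
    unfolding leads_def using c d by (metis mult_eq_0_iff)
qed

lemma leads_single: "c \<noteq> 0 \<Longrightarrow> leads r a (Poly_Mapping.single a c)"
  unfolding leads_def by (intro exI[of _ 0] exI[of _ c]) simp

lemma dominated_single: "dominated r a (Poly_Mapping.single (a + expo r e) c)"
  by (auto simp: dominated_def split: if_splits)

text \<open>The largest power of the variable of index \<open>r\<close> that occurs serves as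
  leading monomial; it does not count towards the degree in the other variables.\<close>

lemma leads_0I:
  assumes "p \<noteq> 0" "\<And>m. m \<in> Poly_Mapping.keys p \<Longrightarrow> \<exists>e. m = expo r e"
  shows "leads r 0 p"
proof -
  have ne: "Poly_Mapping.keys p \<noteq> {}" using assms(1) by (metis in_keys_iff empty_iff lookup_zero poly_mapping_eqI)
  define M where "M = Max (Poly_Mapping.keys p)"
  have M: "M \<in> Poly_Mapping.keys p" unfolding M_def using ne by (intro Max_in) auto
  obtain e where e: "M = expo r e" using assms M by blast
  let ?c = "Poly_Mapping.lookup p M"
  define q where "q = Poly_Mapping.update M 0 p"
  have "p = Poly_Mapping.single M ?c + q"
    by (rule poly_mapping_eqI) (simp add: q_def lookup_add lookup_update lookup_single when_def)
  moreover have "m < M" if "m \<in> Poly_Mapping.keys q" for m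
    using that unfolding q_def M_def by (auto simp: keys_update intro!: order.not_eq_order_implies_strict)
  ultimately show ?thesis
    using M unfolding leads_def e by (intro exI[of _ e] exI[of _ ?c] exI[of _ q]) (auto simp: in_keys_iff e)
qed

section \<open>Chains of positions in a reduced word\<close>

text \<open>A chain is kept as a set of positions, with the relation imposed on neighbouring
  elements only, since \<open>D\<close> need not be transitive; splicing two chains is then a union
  of sets.\<close>

definition chain :: "(nat \<Rightarrow> nat) \<Rightarrow> (nat \<Rightarrow> nat \<Rightarrow> bool) \<Rightarrow> nat set \<Rightarrow> bool" where
  "chain x D C \<longleftrightarrow> finite C \<and>
     (\<forall>p\<in>C. \<forall>q\<in>C. p < q \<longrightarrow> (\<forall>z\<in>C. \<not> (p < z \<and> z < q)) \<longrightarrow> D (x p) (x q))"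

text \<open>As an exponent, this is the product of the variables belonging to the letters of the
  chain.\<close>

definition weight :: "(nat \<Rightarrow> nat) \<Rightarrow> nat set \<Rightarrow> (nat \<Rightarrow>\<^sub>0 nat)" where
  "weight x C = (\<Sum>p\<in>C. expo (x p) 1)"

lemma lookup_weight:
  "finite C \<Longrightarrow> Poly_Mapping.lookup (weight x C) u = card {p \<in> C. x p = u}"
  by (induction C rule: finite_induct)
    (auto simp: weight_def lookup_add lookup_single when_def card_insert_if Collect_conv_if
      insert_Collect [symmetric] conj_disj_distribR Collect_disj_eq)

text \<open>With \<open>D\<close> read as not commuting, this says that no two occurrences of a
  letter can be brought together by commutations.\<close>

definition reduced_seq :: "(nat \<Rightarrow> nat) \<Rightarrow> (nat \<Rightarrow> nat \<Rightarrow> bool) \<Rightarrow> nat \<Rightarrow> bool" where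
  "reduced_seq x D L \<longleftrightarrow>
     (\<forall>i j. i < j \<longrightarrow> j < L \<longrightarrow> x i = x j \<longrightarrow> (\<exists>q. i < q \<and> q < j \<and> D (x q) (x i)))"

text \<open>Both \<open>s\<close> and \<open>t\<close> belong to the union, so two neighbouring
  elements cannot lie on opposite sides of either; they are neighbours in \<open>B\<close>, in the
  middle part or in \<open>A\<close>, where the relation is known.\<close>

lemma chain_splice:
  assumes A: "chain x D A" and B: "chain x D B"
    and ends: "s \<in> B" "t \<in> A" and Q: "finite Q" "\<And>q. q \<in> Q \<Longrightarrow> s < q \<and> q < t"
    and mid: "chain x D (insert s (insert t Q))" and st: "s \<le> t"
  shows "chain x D ({p \<in> B. p \<le> s} \<union> Q \<union> {p \<in> A. t \<le> p})" (is "chain x D ?N")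
  unfolding chain_def
proof (intro conjI ballI impI)
  show "finite ?N" using A B Q by (auto simp: chain_def)
  fix p q assume pq: "p \<in> ?N" "q \<in> ?N" "p < q" and no: "\<forall>z\<in>?N. \<not> (p < z \<and> z < q)"
  have sN: "s \<in> ?N" "t \<in> ?N" using ends by auto
  consider "q \<le> s" | "s \<le> p" "q \<le> t" | "t \<le> p"
    using no sN pq(3) by (meson not_le)
  then show "D (x p) (x q)"
  proof cases
    case 1
    have "z \<in> B" if "z \<in> ?N" "z \<le> s" for z
      using that Q(2)[of z] ends(1) st by (cases "z = s") auto
    then have "p \<in> B" "q \<in> B" using pq 1 by (meson less_imp_le order_trans)+
    moreover have "\<not> (p < z \<and> z < q)" if "z \<in> B" for z
      using no that 1 by force
    ultimately show ?thesis using B pq(3) unfolding chain_def by blast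
  next
    case 2
    have "p \<in> insert s (insert t Q)" "q \<in> insert s (insert t Q)"
      using 2 pq by auto
    moreover have "\<not> (p < z \<and> z < q)" if "z \<in> insert s (insert t Q)" for z
      using that no sN by blast
    ultimately show ?thesis using mid pq(3) unfolding chain_def by blast
  next
    case 3
    have "z \<in> A" if "z \<in> ?N" "t \<le> z" for z
      using that Q(2)[of z] ends(2) st by (cases "z = t") auto
    then have "p \<in> A" "q \<in> A" using pq 3 by (meson less_imp_le order_trans)+
    moreover have "\<not> (p < z \<and> z < q)" if "z \<in> A" for z
      using no that 3 by force
    ultimately show ?thesis using A pq(3) unfolding chain_def by blast
  qed
qed

text \<open>Let \<open>w\<close> be the letter of highest priority at which \<open>A\<close> and \<open>B\<close> differ and let \<open>i\<close>, in
  \<open>A\<close>, be the last position of \<open>w\<close> at which they differ. Since \<open>B\<close> has as many positions of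
  \<open>w\<close> as \<open>A\<close>, following \<open>B\<close> up to somewhere before \<open>i\<close> and then \<open>A\<close> gains one \<open>w\<close>.\<close>

lemma chain_exchange:
  assumes red: "reduced_seq x D L" and sym: "\<And>a b. D a b \<Longrightarrow> D b a"
    and A: "chain x D A" "A \<subseteq> {..<L}" and B: "chain x D B" "B \<subseteq> {..<L}"
    and wt: "weight x A = weight x B"
    and prio: "\<And>u p. u < w \<Longrightarrow> x p = u \<Longrightarrow> p \<in> A \<longleftrightarrow> p \<in> B"
    and i: "i \<in> A" "i \<notin> B" "x i = w"
    and last: "\<And>p. x p = w \<Longrightarrow> i < p \<Longrightarrow> p \<in> A \<longleftrightarrow> p \<in> B"
  obtains N where "chain x D N" "N \<subseteq> {..<L}" "N \<noteq> {}" "Max N = Max A" "weight x A < weight x N"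
proof -
  note goal = that
  have fin: "finite A" "finite B" using A B by (auto simp: chain_def)
  \<comment> \<open>Occurrences of \<open>w\<close> are counted before and after \<open>i\<close>:
    the equal weights force \<open>B\<close> to have one more of them before \<open>i\<close> than
    \<open>A\<close>.\<close>
  define Bl where "Bl = {p \<in> B. x p = w \<and> p < i}"
  define Al where "Al = {p \<in> A. x p = w \<and> p < i}"
  define Ag where "Ag = {p \<in> A. x p = w \<and> i < p}"
  have finl: "finite Bl" "finite Al" "finite Ag" unfolding Bl_def Al_def Ag_def using fin by auto
  have "p \<in> B \<and> x p = w \<longleftrightarrow> p \<in> Bl \<union> Ag" for p
    using i last[of p] by (cases p i rule: linorder_cases) (auto simp: Bl_def Ag_def)
  then have "{p \<in> B. x p = w} = Bl \<union> Ag" by blast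
  then have cB: "card {p \<in> B. x p = w} = card Bl + card Ag"
    using finl by (simp add: card_Un_disjoint Bl_def Ag_def disjoint_iff)
  have "p \<in> A \<and> x p = w \<longleftrightarrow> p \<in> insert i (Al \<union> Ag)" for p
    using i by (cases p i rule: linorder_cases) (auto simp: Al_def Ag_def)
  then have "{p \<in> A. x p = w} = insert i (Al \<union> Ag)" by blast
  then have cA: "card {p \<in> A. x p = w} = Suc (card Al + card Ag)"
    using finl by (simp add: card_Un_disjoint Al_def Ag_def disjoint_iff)
  have "card {p \<in> A. x p = w} = card {p \<in> B. x p = w}"
    using lookup_weight[OF fin(1)] lookup_weight[OF fin(2)] wt by metis
  with cA cB have cl: "card Bl = Suc (card Al)" by simp
  then have "Bl \<noteq> {}" by auto
  define i' where "i' = Max Bl"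
  have i'_in: "i' \<in> Bl" unfolding i'_def using finl \<open>Bl \<noteq> {}\<close> by (intro Max_in)
  have i'_max: "p \<le> i'" if "p \<in> Bl" for p unfolding i'_def using finl that by simp
  have i': "i' \<in> B" "x i' = w" "i' < i" using i'_in by (auto simp: Bl_def)
  \<comment> \<open>The chain sought follows \<open>B\<close> up to \<open>s\<close>, passes through
    \<open>Q\<close> and follows \<open>A\<close> from \<open>t\<close>. It contains
    \<open>Bl\<close>, \<open>i\<close> and \<open>Ag\<close>, one \<open>w\<close> more than
    \<open>A\<close>. For a letter before \<open>w\<close>, the positions in \<open>A\<close> also
    lie in \<open>B\<close>, and by \<open>no\<close> none of them falls strictly between
    \<open>s\<close> and \<open>t\<close>.\<close>
  have result: thesis
    if s: "s \<in> B" "i' \<le> s" and t: "t \<in> A" "t \<le> i" and st: "s \<le> t"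
      and Q: "finite Q" "\<And>q. q \<in> Q \<Longrightarrow> s < q \<and> q < t"
      and mid: "chain x D (insert s (insert t Q))"
      and no: "\<And>p. p \<in> A \<Longrightarrow> p \<in> B \<Longrightarrow> p \<le> s \<or> t \<le> p" for s t Q
  proof -
    let ?N = "{p \<in> B. p \<le> s} \<union> Q \<union> {p \<in> A. t \<le> p}"
    have finN: "finite ?N" using fin Q by auto
    have chainN: "chain x D ?N"
      by (rule chain_splice[OF A(1) B(1) s(1) t(1) Q mid st])
    have "Max ?N = Max A"
    proof (rule Max_eqI)
      have MA: "Max A \<in> A" using fin i by (intro Max_in) auto
      moreover have "t \<le> Max A" using fin t by simp
      ultimately show "Max A \<in> ?N" by auto
      fix p assume "p \<in> ?N"
      then have "p \<le> t \<or> p \<in> A" using st Q(2) by fastforce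
      then show "p \<le> Max A" using fin \<open>t \<le> Max A\<close> by auto
    qed (rule finN)
    moreover have "?N \<subseteq> {..<L}" using A B Q(2) t by fastforce
    moreover have "weight x A < weight x ?N"
    proof (rule poly_mapping_less_if_lookup_le[of w])
      fix u assume u: "u < w"
      have "{p \<in> A. x p = u} \<subseteq> {p \<in> ?N. x p = u}"
        using no prio[OF u] by auto
      then show "Poly_Mapping.lookup (weight x A) u \<le> Poly_Mapping.lookup (weight x ?N) u"
        unfolding lookup_weight[OF fin(1)] lookup_weight[OF finN]
        using finN by (intro card_mono) auto
    next
      have "insert i (Bl \<union> Ag) \<subseteq> {p \<in> ?N. x p = w}"
      proof -
        have "p \<le> s" if "p \<in> Bl" for p using i'_max[OF that] s by simp
        then show ?thesis using i t by (auto simp: Bl_def Ag_def)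
      qed
      then have "card (insert i (Bl \<union> Ag)) \<le> card {p \<in> ?N. x p = w}"
        using finN by (intro card_mono) auto
      moreover have "card (insert i (Bl \<union> Ag)) = Suc (card Bl + card Ag)"
        using finl by (simp add: card_Un_disjoint Bl_def Ag_def disjoint_iff)
      ultimately show "Poly_Mapping.lookup (weight x A) w < Poly_Mapping.lookup (weight x ?N) w"
        unfolding lookup_weight[OF fin(1)] lookup_weight[OF finN] cA cl by simp
    qed
    moreover have "?N \<noteq> {}" using s by auto
    ultimately show thesis by - (rule goal[OF chainN])
  qed
  \<comment> \<open>Either the chains meet strictly between \<open>i'\<close> and \<open>i\<close>
    and the changeover happens there, or reducedness supplies a \<open>q\<close> through which
    \<open>i'\<close> and \<open>i\<close> can be joined; in the second case no common position is
    skipped.\<close>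
  show thesis
  proof (cases "\<exists>z. z \<in> A \<and> z \<in> B \<and> i' < z \<and> z < i")
    case True
    then obtain z where "z \<in> A" "z \<in> B" "i' < z" "z < i" by blast
    then show thesis by (intro result[of z z "{}"]) (auto simp: chain_def)
  next
    case False
    obtain q where q: "i' < q" "q < i" "D (x q) w"
    proof -
      have "i < L" using i(1) A(2) by auto
      then have "\<exists>q. i' < q \<and> q < i \<and> D (x q) (x i')"
        using red[unfolded reduced_seq_def, rule_format, of i' i] i'(2,3) i(3) by simp
      then show ?thesis using that i'(2) by auto
    qed
    show thesis
    proof (rule result[of i' i "{q}"])
      show "chain x D (insert i' (insert i {q}))"
        using q i' i sym by (auto simp: chain_def)
      fix p assume "p \<in> A" "p \<in> B"
      with False show "p \<le> i' \<or> i \<le> p" by (meson not_le)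
    qed (use q i' i in auto)
  qed
qed

text \<open>The chain containing the last difference in the first differing letter plays the role of
  \<open>A\<close> in \<open>chain_exchange\<close>; equality of the weights makes the two cases
  symmetric.\<close>

lemma heavier_chain:
  assumes red: "reduced_seq x D L" and sym: "\<And>a b. D a b \<Longrightarrow> D b a"
    and A: "chain x D A" "A \<subseteq> {..<L}" and B: "chain x D B" "B \<subseteq> {..<L}"
    and wt: "weight x A = weight x B" and ne: "A \<noteq> B"
  shows "\<exists>N. chain x D N \<and> N \<subseteq> {..<L} \<and> N \<noteq> {} \<and> (Max N = Max A \<or> Max N = Max B) \<and>
    weight x A < weight x N"
proof -
  let ?dif = "\<lambda>p. (p \<in> A) \<noteq> (p \<in> B)"
  let ?P = "\<lambda>u. \<exists>p. x p = u \<and> ?dif p"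
  define w where "w = (LEAST u. ?P u)"
  have "\<exists>u. ?P u" using ne by blast
  then have w: "?P w" unfolding w_def by (rule LeastI_ex)
  have prio: "p \<in> A \<longleftrightarrow> p \<in> B" if "u < w" "x p = u" for u p
    using not_less_Least[of u ?P] that unfolding w_def by blast
  define S where "S = {p. x p = w \<and> ?dif p}"
  have finS: "finite S"
    by (rule finite_subset[of _ "A \<union> B"]) (use A B in \<open>auto simp: S_def chain_def\<close>)
  moreover have "S \<noteq> {}" using w by (auto simp: S_def)
  ultimately have iS: "Max S \<in> S" by (rule Max_in)
  have le: "p \<le> Max S" if "p \<in> S" for p by (rule Max_ge[OF finS that])
  have last: "p \<in> A \<longleftrightarrow> p \<in> B" if "x p = w" "Max S < p" for p
    using le[of p] that by (auto simp: S_def)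
  have xi: "x (Max S) = w" using iS by (auto simp: S_def)
  have "Max S \<in> A \<and> Max S \<notin> B \<or> Max S \<in> B \<and> Max S \<notin> A"
    using iS by (auto simp: S_def)
  then show ?thesis
  proof
    assume i: "Max S \<in> A \<and> Max S \<notin> B"
    show ?thesis
      by (rule chain_exchange[OF red sym A B wt prio _ _ xi last]) (use i in blast)+
  next
    assume i: "Max S \<in> B \<and> Max S \<notin> A"
    show ?thesis
      by (rule chain_exchange[OF red sym B A wt[symmetric] prio[symmetric] _ _ xi last[symmetric]])
        (use i wt in auto)
  qed
qed

text \<open>This is the largest weight of a nonempty chain ending at \<open>j\<close>, as
  \<open>chain_weight_le_height\<close> and \<open>chain_of_height\<close> show. The 0 among the
  candidates accounts for the chain \<open>{j}\<close> and keeps the maximum defined when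
  \<open>j\<close> has no predecessors.\<close>

function height :: "(nat \<Rightarrow> nat) \<Rightarrow> (nat \<Rightarrow> nat \<Rightarrow> bool) \<Rightarrow> nat \<Rightarrow> (nat \<Rightarrow>\<^sub>0 nat)" where
  "height x D j = expo (x j) 1 + Max (insert 0 (height x D ` {i. i < j \<and> D (x i) (x j)}))"
  by auto
termination
  by (relation "measure (\<lambda>(x, D, j). j)") auto

declare height.simps [simp del]

lemma height_step:
  assumes "i < j" "D (x i) (x j)"
  shows "expo (x j) 1 + height x D i \<le> height x D j"
  unfolding height.simps[of x D j] using assms
  by (intro add_left_mono Max_ge) auto

lemma expo_le_height: "expo (x j) 1 \<le> height x D j"
  unfolding height.simps[of x D j]
  by (rule add_increasing2) (auto intro: Max_ge poly_mapping_nat_ge_0)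

lemma expo_pos: "0 < expo v 1"
  using poly_mapping_nat_ge_0[of "expo v 1"]
  by (metis order.not_eq_order_implies_strict lookup_single_eq lookup_zero zero_neq_one)

text \<open>Unless nothing is left, removing the last position leaves a chain that ends at a
  predecessor, so the induction hypothesis and \<open>height_step\<close> apply.\<close>

lemma chain_weight_le_height:
  "chain x D C \<Longrightarrow> C \<noteq> {} \<Longrightarrow> weight x C \<le> height x D (Max C)"
proof (induction "Max C" arbitrary: C rule: less_induct)
  case less
  have fin: "finite C" using less.prems by (simp add: chain_def)
  define j where "j = Max C"
  have j: "j \<in> C" unfolding j_def by (rule Max_in[OF fin less.prems(2)])
  have le: "p \<le> j" if "p \<in> C" for p unfolding j_def by (rule Max_ge[OF fin that])
  let ?C = "C - {j}"
  have wt: "weight x C = expo (x j) 1 + weight x ?C"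
    unfolding weight_def by (rule sum.remove[OF fin j])
  show ?case
  proof (cases "?C = {}")
    case True
    then have "weight x ?C = 0" by (simp only: weight_def sum.empty)
    then show ?thesis using wt expo_le_height[of x j D] by (simp add: j_def)
  next
    case False
    define i where "i = Max ?C"
    have finC: "finite ?C" using fin by simp
    have i: "i \<in> ?C" unfolding i_def by (rule Max_in[OF finC False])
    have ile: "p \<le> i" if "p \<in> ?C" for p unfolding i_def by (rule Max_ge[OF finC that])
    have "i < j" using i le[of i] by auto
    have "\<not> (i < z \<and> z < j)" if "z \<in> C" for z using ile[of z] that by auto
    then have "D (x i) (x j)"
      using less.prems(1) i j \<open>i < j\<close> unfolding chain_def by blast
    have "chain x D ?C"
      unfolding chain_def
    proof (intro conjI ballI impI)
      fix p q assume pq: "p \<in> ?C" "q \<in> ?C" "p < q" "\<forall>z\<in>?C. \<not> (p < z \<and> z < q)"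
      have "\<not> (p < z \<and> z < q)" if "z \<in> C" for z
        using pq(4) that le[of q] pq(2) by (cases "z = j") auto
      then show "D (x p) (x q)" using less.prems(1) pq unfolding chain_def by blast
    qed (rule finC)
    then have "weight x ?C \<le> height x D i"
      unfolding i_def using less.hyps[of ?C] False \<open>i < j\<close> by (simp add: i_def j_def)
    then have "weight x C \<le> expo (x j) 1 + height x D i" unfolding wt by (rule add_left_mono)
    also have "\<dots> \<le> height x D j" by (rule height_step) fact+
    finally show ?thesis unfolding j_def .
  qed
qed

lemma chain_of_height: "\<exists>C. chain x D C \<and> C \<noteq> {} \<and> Max C = j \<and> weight x C = height x D j"
proof (induction j rule: less_induct)
  case (less j)
  let ?H = "insert 0 (height x D ` {i. i < j \<and> D (x i) (x j)})"
  have "finite ?H" by simp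
  then have "Max ?H \<in> ?H" by (intro Max_in) auto
  then consider "Max ?H = 0" | i where "i < j" "D (x i) (x j)" "Max ?H = height x D i" by blast
  then show ?case
  proof cases
    case 1
    then have "height x D j = expo (x j) 1" by (simp add: height.simps[of x D j])
    then show ?thesis by (intro exI[of _ "{j}"]) (auto simp: chain_def weight_def)
  next
    case (2 i)
    then obtain C where C: "chain x D C" "C \<noteq> {}" "Max C = i" "weight x C = height x D i"
      using less by blast
    have fin: "finite C" using C by (simp add: chain_def)
    have i: "i \<in> C" using Max_in[OF fin C(2)] C(3) by simp
    have le: "p \<le> i" if "p \<in> C" for p using Max_ge[OF fin that] C(3) by simp
    have "chain x D (insert j C)"
      unfolding chain_def
    proof (intro conjI ballI impI)
      fix p q assume pq: "p \<in> insert j C" "q \<in> insert j C" "p < q"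
        "\<forall>z\<in>insert j C. \<not> (p < z \<and> z < q)"
      have p: "p \<in> C" using pq le 2(1) by fastforce
      show "D (x p) (x q)"
      proof (cases "q = j")
        case True
        have "\<not> p < i" using pq(4) i True 2(1) by auto
        then have "p = i" using le[OF p] by simp
        then show ?thesis using 2 True by simp
      next
        case False
        then show ?thesis using C(1) pq p unfolding chain_def by blast
      qed
    qed (use fin in simp)
    moreover have "Max (insert j C) = j" using fin le 2(1) by (intro Max_eqI) fastforce+
    moreover have "weight x (insert j C) = height x D j"
    proof -
      have "j \<notin> C" using le 2(1) by fastforce
      then have "weight x (insert j C) = expo (x j) 1 + weight x C"
        using fin by (simp add: weight_def)
      then show ?thesis using 2(3) C(4) by (simp add: height.simps[of x D j])
    qed
    ultimately show ?thesis by blast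
  qed
qed

text \<open>Take chains realising the two equal heights. If they differ,
  \<open>heavier_chain\<close> yields a chain ending at \<open>j\<close> or \<open>k\<close> that
  outweighs both, against maximality; if they coincide, so do their last positions.\<close>

lemma height_inj_on:
  assumes "reduced_seq x D L" "\<And>a b. D a b \<Longrightarrow> D b a"
  shows "inj_on (height x D) {..<L}"
proof (rule inj_onI)
  fix j k assume jk: "j \<in> {..<L}" "k \<in> {..<L}" and eq: "height x D j = height x D k"
  obtain A where A: "chain x D A" "A \<noteq> {}" "Max A = j" "weight x A = height x D j"
    using chain_of_height by blast
  obtain B where B: "chain x D B" "B \<noteq> {}" "Max B = k" "weight x B = height x D k"
    using chain_of_height by blast
  have "C \<subseteq> {..<L}" if "chain x D C" "Max C < L" for C
  proof
    fix p assume "p \<in> C"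
    then have "p \<le> Max C" using that(1) by (intro Max_ge) (simp_all add: chain_def)
    then show "p \<in> {..<L}" using that(2) by simp
  qed
  then have sub: "A \<subseteq> {..<L}" "B \<subseteq> {..<L}" using A B jk by auto
  have "A = B"
  proof (rule ccontr)
    assume "A \<noteq> B"
    have "weight x A = weight x B" using A(4) B(4) eq by simp
    from heavier_chain[OF assms A(1) sub(1) B(1) sub(2) this \<open>A \<noteq> B\<close>]
    obtain N where N: "chain x D N" "N \<noteq> {}" "Max N = j \<or> Max N = k" "weight x A < weight x N"
      unfolding A(3) B(3) by blast
    have "weight x N \<le> height x D (Max N)" by (rule chain_weight_le_height[OF N(1,2)])
    also have "\<dots> = weight x A" using N(3) A(4) eq by auto
    finally show False using N(4) by simp
  qed
  with A B show "j = k" by simp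
qed

text \<open>The position \<open>q\<close> separating the two occurrences is related to both, so the
  height grows from \<open>p\<close> to \<open>q\<close> and again from \<open>q\<close> to
  \<open>j\<close>.\<close>

lemma height_less_same_letter:
  assumes red: "reduced_seq x D L" and sym: "\<And>a b. D a b \<Longrightarrow> D b a"
    and "p < j" "j < L" "x p = x j"
  shows "height x D p < height x D j"
proof -
  obtain q where q: "p < q" "q < j" "D (x q) (x p)"
    using red assms unfolding reduced_seq_def by blast
  have "height x D p < expo (x q) 1 + height x D p" using expo_pos by (rule add_strict_increasing) simp
  also have "\<dots> \<le> height x D q" using q sym by (intro height_step) auto
  also have "\<dots> < expo (x j) 1 + height x D q" using expo_pos by (rule add_strict_increasing) simp
  also have "\<dots> \<le> height x D j" using q assms by (intro height_step) auto
  finally show ?thesis .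
qed

lemma keys_height:
  assumes "\<And>i. i \<le> j \<Longrightarrow> x i < r"
  shows "Poly_Mapping.keys (height x D j) \<subseteq> {..<r}"
  using assms
proof (induction j rule: less_induct)
  case (less j)
  let ?H = "insert 0 (height x D ` {i. i < j \<and> D (x i) (x j)})"
  have "finite ?H" by simp
  then have "Max ?H \<in> ?H" by (intro Max_in) auto
  then have "Poly_Mapping.keys (Max ?H) \<subseteq> {..<r}"
    using less by (auto simp: subset_iff)
  then show ?case
    unfolding height.simps[of x D j] using Poly_Mapping.keys_add[of "expo (x j) 1" "Max ?H"] less(2)[of j]
    by (auto split: if_splits)
qed

section \<open>The operators\<close>

abbreviation const_poly :: "'a::zero \<Rightarrow> 'a mpoly" where
  "const_poly c \<equiv> Poly_Mapping.single 0 c"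

lemma const_poly_sum: "const_poly (sum f I) = (\<Sum>i\<in>I. const_poly (f i))"
  by (induction I rule: infinite_finite_induct) (auto simp: single_add)

lemma const_poly_mult: "const_poly (a * b) = const_poly a * const_poly b"
  by (simp add: mult_single)

lemma poly_vars_sum:
  "(\<And>i. i \<in> I \<Longrightarrow> f i \<in> poly_vars k) \<Longrightarrow> (sum f I :: 'a::ring_1 mpoly) \<in> poly_vars k"
  by (induction I rule: infinite_finite_induct) (auto intro: poly_vars_0 poly_vars_add)

lemma poly_vars_diff:
  "p \<in> poly_vars k \<Longrightarrow> q \<in> poly_vars k \<Longrightarrow> (p - q :: 'a::ring_1 mpoly) \<in> poly_vars k"
  using poly_vars_add[OF _ poly_vars_uminus, of p k q] by simp

lemma poly_vars_single: "Poly_Mapping.keys m \<subseteq> {..<k} \<Longrightarrow> Poly_Mapping.single m c \<in> poly_vars k"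
  by (auto simp: poly_vars_def)

lemma mat_mult_entry:
  assumes "A \<in> carrier_mat n n" "B \<in> carrier_mat n n" "i < n" "j < n"
  shows "(A * B) $$ (i, j) = (\<Sum>k<n. A $$ (i, k) * B $$ (k, j))"
  using assms by (simp add: scalar_prod_def atLeast0LessThan)

text \<open>\<open>D u v\<close> says that \<open>u\<close> and \<open>v\<close> are distinct and not adjacent. The variables are one
  \<open>s\<^sub>v\<close>, of index \<open>idx v\<close>, for every vertex and \<open>y\<close>, of index \<open>r\<close>. A function of the
  coordinates \<open>None\<close> and \<open>Some (v, l)\<close> with \<open>l < d v\<close> is a column vector.\<close>

locale vertex_rep =
  fixes V :: "'v set" and D :: "'v \<Rightarrow> 'v \<Rightarrow> bool" and idx :: "'v \<Rightarrow> nat" and d :: "'v \<Rightarrow> nat"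
    and r :: nat
  assumes finite_V: "finite V"
    and D_sym: "D u v \<Longrightarrow> D v u"
    and D_irrefl: "\<not> D v v"
    and idx_inj: "inj_on idx V"
    and idx_less: "v \<in> V \<Longrightarrow> idx v < r"
begin

definition sigma :: "'v \<Rightarrow> (('v \<times> nat) option \<Rightarrow> 'a mpoly) \<Rightarrow> 'a::ring_1 mpoly" where
  "sigma v f = (\<Sum>l<d v. Poly_Mapping.single (expo r (l * d v)) 1 * f (Some (v, l)))"

definition tau :: "'v \<Rightarrow> (('v \<times> nat) option \<Rightarrow> 'a mpoly) \<Rightarrow> 'a::ring_1 mpoly" where
  "tau v f = f None + (\<Sum>u | u \<in> V \<and> D u v. sigma u f)"

definition shift :: "'v \<Rightarrow> (('v \<times> nat) option \<Rightarrow> 'a mpoly) \<Rightarrow> nat \<Rightarrow> 'a::ring_1 mpoly" where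
  "shift v f l = Poly_Mapping.single (expo (idx v) 1 + expo r l) 1 * tau v f"

definition step ::
  "'v \<Rightarrow> 'a mat \<Rightarrow> (('v \<times> nat) option \<Rightarrow> 'a mpoly) \<Rightarrow> (('v \<times> nat) option \<Rightarrow> 'a::ring_1 mpoly)" where
  "step v A f = (\<lambda>i. case i of None \<Rightarrow> f None
     | Some (u, l) \<Rightarrow> if u = v \<and> l < d v
         then (\<Sum>k<d v. const_poly (A $$ (l, k)) * (f (Some (v, k)) + shift v f k)) - shift v f l
         else f i)"

lemma step_None [simp]: "step v A f None = f None"
  by (simp add: step_def)

lemma step_same: "l < d v \<Longrightarrow> step v A f (Some (v, l)) =
    (\<Sum>k<d v. const_poly (A $$ (l, k)) * (f (Some (v, k)) + shift v f k)) - shift v f l"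
  by (simp add: step_def)

lemma step_other [simp]: "\<not> (u = v \<and> l < d v) \<Longrightarrow> step v A f (Some (u, l)) = f (Some (u, l))"
  by (auto simp: step_def)

lemma step_outside: "\<not> (\<exists>l<d v. i = Some (v, l)) \<Longrightarrow> step v A f i = f i"
  by (auto simp: step_def split: option.splits)

lemma sigma_step_other: "u \<noteq> v \<Longrightarrow> sigma u (step v A f) = sigma u f"
  by (simp add: sigma_def)

text \<open>\<open>v\<close> is then not among the vertices summed in \<open>tau u\<close>; this
  covers \<open>u = v\<close> as well as the neighbours of \<open>v\<close>.\<close>

lemma tau_step: "\<not> D v u \<Longrightarrow> tau u (step v A f) = tau u f"
  unfolding tau_def by (auto intro!: sum.cong sigma_step_other)

lemma shift_step: "\<not> D v u \<Longrightarrow> shift u (step v A f) = shift u f"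
  by (simp add: shift_def fun_eq_iff tau_step)

text \<open>\<open>step v B\<close> leaves the shift of \<open>v\<close> unchanged, so the shift it
  subtracts is exactly the one that \<open>step v A\<close> adds back, and the two matrices meet
  directly.\<close>

lemma step_mult:
  assumes "A \<in> carrier_mat (d v) (d v)" "B \<in> carrier_mat (d v) (d v)"
  shows "step v (A * B) f = step v A (step v B f)"
proof
  fix i
  show "step v (A * B) f i = step v A (step v B f) i"
  proof (cases "\<exists>l<d v. i = Some (v, l)")
    case True
    then obtain l where l: "l < d v" and i: "i = Some (v, l)" by blast
    let ?z = "\<lambda>k. f (Some (v, k)) + shift v f k"
    have "step v A (step v B f) i =
        (\<Sum>k<d v. const_poly (A $$ (l, k)) * (\<Sum>m<d v. const_poly (B $$ (k, m)) * ?z m)) - shift v f l"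
      using l i by (simp add: step_same shift_step D_irrefl)
    also have "(\<Sum>k<d v. const_poly (A $$ (l, k)) * (\<Sum>m<d v. const_poly (B $$ (k, m)) * ?z m)) =
        (\<Sum>k<d v. \<Sum>m<d v. const_poly (A $$ (l, k)) * const_poly (B $$ (k, m)) * ?z m)"
      by (simp add: sum_distrib_left mult.assoc)
    also have "\<dots> = (\<Sum>m<d v. \<Sum>k<d v. const_poly (A $$ (l, k)) * const_poly (B $$ (k, m)) * ?z m)"
      by (rule sum.swap)
    also have "\<dots> = (\<Sum>m<d v. const_poly ((A * B) $$ (l, m)) * ?z m)"
    proof (rule sum.cong[OF HOL.refl])
      fix m assume "m \<in> {..<d v}"
      then have "const_poly ((A * B) $$ (l, m)) = (\<Sum>k<d v. const_poly (A $$ (l, k)) * const_poly (B $$ (k, m)))"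
        using assms l by (simp only: mat_mult_entry const_poly_sum const_poly_mult lessThan_iff)
      then show "(\<Sum>k<d v. const_poly (A $$ (l, k)) * const_poly (B $$ (k, m)) * ?z m) =
          const_poly ((A * B) $$ (l, m)) * ?z m"
        by (simp only: sum_distrib_right)
    qed
    finally show ?thesis using l i by (simp add: step_same)
  next
    case False
    then show ?thesis by (simp add: step_outside)
  qed
qed

lemma step_one: "step v (1\<^sub>m (d v)) f = f"
proof
  fix i
  show "step v (1\<^sub>m (d v)) f i = f i"
  proof (cases "\<exists>l<d v. i = Some (v, l)")
    case True
    then obtain l where l: "l < d v" and i: "i = Some (v, l)" by blast
    let ?z = "\<lambda>k. f (Some (v, k)) + shift v f k"
    have "(\<Sum>k<d v. const_poly (1\<^sub>m (d v) $$ (l, k)) * ?z k) = (\<Sum>k<d v. if l = k then ?z k else 0)"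
      using l by (intro sum.cong) auto
    then show ?thesis using l i by (simp add: step_same)
  next
    case False
    then show ?thesis by (simp add: step_outside)
  qed
qed

text \<open>The two operators change disjoint sets of coordinates, and neither changes the shift
  used by the other.\<close>

lemma step_commute:
  assumes "u \<noteq> v" "\<not> D u v"
  shows "step u A (step v B f) = step v B (step u A f)"
proof
  fix i
  have D: "\<not> D v u" using assms D_sym by blast
  show "step u A (step v B f) i = step v B (step u A f) i"
  proof (cases i)
    case (Some p)
    obtain w l where p: "p = (w, l)" by (cases p)
    consider "w = u" "l < d u" | "w = v" "l < d v" | "\<not> (w = u \<and> l < d u)" "\<not> (w = v \<and> l < d v)" by blast
    then show ?thesis
      using assms D by cases (simp_all add: Some p step_same shift_step)
  qed simp
qed

section \<open>Right linearity, coefficients and support of the operators\<close>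

lemma sigma_add: "sigma v (\<lambda>i. f i + g i) = sigma v f + sigma v g"
  by (simp add: sigma_def distrib_left sum.distrib)

lemma tau_add: "tau v (\<lambda>i. f i + g i) = tau v f + tau v g"
  by (simp add: tau_def sigma_add sum.distrib algebra_simps)

lemma step_add: "step v A (\<lambda>i. f i + g i) = (\<lambda>i. step v A f i + step v A g i)"
proof
  fix i show "step v A (\<lambda>i. f i + g i) i = step v A f i + step v A g i"
    by (cases i)
      (auto simp: step_def shift_def tau_add distrib_left sum.distrib algebra_simps split: prod.splits)
qed

lemma sigma_scale: "sigma v (\<lambda>i. f i * c) = sigma v f * c"
  by (simp add: sigma_def sum_distrib_right mult.assoc)

lemma tau_scale: "tau v (\<lambda>i. f i * c) = tau v f * c"
  by (simp add: tau_def sigma_scale sum_distrib_right distrib_right)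

text \<open>Matrix entries and monomials multiply from the left, so scalars on the right pass
  through by associativity, although coefficients need not commute. This lets the operators be
  written as matrices acting on columns.\<close>

lemma step_scale: "step v A (\<lambda>i. f i * c) = (\<lambda>i. step v A f i * c)"
proof
  fix i show "step v A (\<lambda>i. f i * c) i = step v A f i * c"
    by (cases i) (auto simp: step_def shift_def tau_scale sum_distrib_right left_diff_distrib distrib_left
        distrib_right mult.assoc intro!: sum.cong split: prod.splits)
qed

lemma step_poly_vars:
  assumes f: "\<And>i. f i \<in> poly_vars (Suc r)" and v: "v \<in> V"
  shows "step v A f i \<in> poly_vars (Suc r)"
proof -
  have sigma: "sigma u f \<in> poly_vars (Suc r)" for u
    unfolding sigma_def by (intro poly_vars_sum poly_vars_mult poly_vars_single f) auto
  have tau: "tau v f \<in> poly_vars (Suc r)"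
    unfolding tau_def by (intro poly_vars_add poly_vars_sum sigma f)
  have "Poly_Mapping.keys (expo (idx v) 1 + expo r l) \<subseteq> {..<Suc r}" for l
    using Poly_Mapping.keys_add[of "expo (idx v) 1" "expo r l"] idx_less[OF v] by (auto split: if_splits)
  then have shift: "shift v f l \<in> poly_vars (Suc r)" for l
    unfolding shift_def by (intro poly_vars_mult poly_vars_single tau)
  have const: "const_poly (c :: 'a::ring_1) \<in> poly_vars (Suc r)" for c
    by (rule poly_vars_single) simp
  show ?thesis
  proof (cases "\<exists>l<d v. i = Some (v, l)")
    case True
    then show ?thesis
      by (auto simp: step_same intro!: poly_vars_diff poly_vars_sum poly_vars_mult poly_vars_add f shift const)
  next
    case False
    then show ?thesis by (simp add: step_outside f)
  qed
qed

definition coords :: "('v \<times> nat) option set" where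
  "coords = insert None (Some ` (SIGMA v:V. {..<d v}))"

lemma finite_coords: "finite coords"
  unfolding coords_def using finite_V by auto

lemma step_support:
  assumes "\<And>i. i \<notin> coords \<Longrightarrow> f i = 0" "v \<in> V" "i \<notin> coords"
  shows "step v A f i = 0"
proof -
  have "\<not> (\<exists>l<d v. i = Some (v, l))" using assms by (auto simp: coords_def)
  then have "step v A f i = f i" by (rule step_outside)
  with assms show ?thesis by simp
qed

end

section \<open>Faithfulness on reduced words\<close>

lemma keys_sum_subset:
  "Poly_Mapping.keys (sum p I) \<subseteq> (\<Union>i\<in>I. Poly_Mapping.keys (p i))"
proof (induction I rule: infinite_finite_induct)
  case (insert i I)
  then show ?case using Poly_Mapping.keys_add[of "p i" "sum p I"] by auto
qed auto

lemma dominated_diff: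
  fixes p q :: "'a::ring_1 mpoly"
  assumes "dominated r a p" "dominated r a q"
  shows "dominated r a (p - q)"
  unfolding dominated_def
proof
  fix m assume "m \<in> Poly_Mapping.keys (p - q)"
  then have "m \<in> Poly_Mapping.keys p \<or> m \<in> Poly_Mapping.keys q"
    by (auto simp: in_keys_iff lookup_minus)
  with assms show "\<exists>e. m \<le> a + expo r e" unfolding dominated_def by blast
qed

text \<open>The exponents \<open>l * n + k\<close> with \<open>k < n\<close> are pairwise distinct,
  so different entries cannot cancel and the nonzero one survives.\<close>

lemma leads_entries:
  fixes c :: "nat \<Rightarrow> nat \<Rightarrow> 'a::ring_1"
  assumes "l0 < n" "k0 < n" "c l0 k0 \<noteq> 0"
  shows "leads r 0 (\<Sum>l<n. \<Sum>k<n. Poly_Mapping.single (expo r (l * n + k)) (c l k))"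
    (is "leads r 0 ?p")
proof (rule leads_0I)
  have inj: "expo r (l * n + k) = expo r (l0 * n + k0) \<longleftrightarrow> l = l0 \<and> k = k0" if "k < n" for l k
  proof
    assume "expo r (l * n + k) = expo r (l0 * n + k0)"
    then have "l * n + k = l0 * n + k0" by (metis lookup_single_eq)
    moreover have "(l * n + k) div n = l" "(l * n + k) mod n = k" "(l0 * n + k0) div n = l0" "(l0 * n + k0) mod n = k0"
      using that assms by auto
    ultimately show "l = l0 \<and> k = k0" by metis
  qed simp
  have "Poly_Mapping.lookup ?p (expo r (l0 * n + k0)) =
      (\<Sum>l<n. \<Sum>k<n. if l = l0 \<and> k = k0 then c l k else 0)"
    unfolding lookup_sum lookup_single by (intro sum.cong HOL.refl) (simp add: inj when_def)
  also have "\<dots> = (\<Sum>l<n. if l = l0 then c l k0 else 0)"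
    using assms by (intro sum.cong HOL.refl) auto
  also have "\<dots> = c l0 k0" using assms by simp
  finally show "?p \<noteq> 0" using assms by auto
next
  fix m assume "m \<in> Poly_Mapping.keys ?p"
  from subsetD[OF keys_sum_subset this]
  obtain l where "m \<in> Poly_Mapping.keys (\<Sum>k<n. Poly_Mapping.single (expo r (l * n + k)) (c l k))"
    by blast
  from subsetD[OF keys_sum_subset this]
  obtain k where "m \<in> Poly_Mapping.keys (Poly_Mapping.single (expo r (l * n + k)) (c l k))"
    by blast
  then show "\<exists>e. m = expo r e" by (auto split: if_splits)
qed

context vertex_rep
begin

text \<open>Separates the contribution of the old coordinates from the new one. In the latter,
  \<open>l * d v\<close> comes from \<open>sigma\<close> and \<open>k\<close> from the shift, which
  gives each entry of \<open>A - 1\<close> its own power of the variable of index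
  \<open>r\<close>.\<close>

lemma sigma_step_same:
  "sigma v (step v A f) =
     (\<Sum>l<d v. Poly_Mapping.single (expo r (l * d v)) 1 * (\<Sum>k<d v. const_poly (A $$ (l, k)) * f (Some (v, k)))) +
     Poly_Mapping.single (expo (idx v) 1) 1 *
       (\<Sum>l<d v. \<Sum>k<d v. Poly_Mapping.single (expo r (l * d v + k)) (A $$ (l, k) - (if l = k then 1 else 0))) *
       tau v f"
proof -
  let ?y = "\<lambda>e. expo r e" and ?s = "expo (idx v) 1" and ?t = "tau v f"
  let ?c = "\<lambda>l k. A $$ (l, k) - (if l = k then 1 else 0)"
  have row: "Poly_Mapping.single (?y (l * d v)) 1 * step v A f (Some (v, l)) =
      Poly_Mapping.single (?y (l * d v)) 1 * (\<Sum>k<d v. const_poly (A $$ (l, k)) * f (Some (v, k))) +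
      (\<Sum>k<d v. Poly_Mapping.single (?s + ?y (l * d v + k)) (?c l k) * ?t)"
    if l: "l < d v" for l
  proof -
    \<comment> \<open>Written as a row of the identity matrix applied to the shift, the subtracted
      term combines with \<open>A\<close> to \<open>A - 1\<close>.\<close>
    have "shift v f l = (\<Sum>k<d v. if l = k then shift v f k else 0)" using l by simp
    also have "\<dots> = (\<Sum>k<d v. const_poly (if l = k then 1 else 0) * shift v f k)"
      by (intro sum.cong HOL.refl) auto
    finally have "step v A f (Some (v, l)) = (\<Sum>k<d v. const_poly (A $$ (l, k)) * f (Some (v, k))) +
        (\<Sum>k<d v. const_poly (?c l k) * shift v f k)"
      using l by (simp add: step_same distrib_left sum.distrib single_diff left_diff_distrib sum_subtractf)
    moreover have "Poly_Mapping.single (?y (l * d v)) 1 * (\<Sum>k<d v. const_poly (?c l k) * shift v f k) =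
        (\<Sum>k<d v. Poly_Mapping.single (?s + ?y (l * d v + k)) (?c l k) * ?t)"
      unfolding sum_distrib_left shift_def mult.assoc[symmetric] mult_single
      by (intro sum.cong HOL.refl) (simp add: single_add ac_simps)
    ultimately show ?thesis by (simp add: distrib_left)
  qed
  have "sigma v (step v A f) =
      (\<Sum>l<d v. Poly_Mapping.single (?y (l * d v)) 1 * (\<Sum>k<d v. const_poly (A $$ (l, k)) * f (Some (v, k)))) +
      (\<Sum>l<d v. \<Sum>k<d v. Poly_Mapping.single (?s + ?y (l * d v + k)) (?c l k) * ?t)"
    unfolding sigma_def by (subst sum.distrib[symmetric]) (intro sum.cong HOL.refl row; simp)
  also have "(\<Sum>l<d v. \<Sum>k<d v. Poly_Mapping.single (?s + ?y (l * d v + k)) (?c l k) * ?t) =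
      Poly_Mapping.single ?s 1 * (\<Sum>l<d v. \<Sum>k<d v. Poly_Mapping.single (?y (l * d v + k)) (?c l k)) * ?t"
    unfolding sum_distrib_left sum_distrib_right mult_single mult_1 ..
  finally show ?thesis .
qed

text \<open>The functional \<open>sigma\<close> of the last letter vanishes on the starting vector,
  while after \<open>L\<close> steps it has a leading term and hence is nonzero.\<close>

lemma orbit_nontrivial:
  fixes vs :: "nat \<Rightarrow> 'v" and As :: "nat \<Rightarrow> 'a::ring_1_no_zero_divisors mat"
    and f :: "nat \<Rightarrow> ('v \<times> nat) option \<Rightarrow> 'a mpoly"
  assumes f_0: "f 0 = (\<lambda>i. if i = None then 1 else 0)"
    and f_Suc: "\<And>j. j < L \<Longrightarrow> f (Suc j) = step (vs j) (As j) (f j)"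
    and vs: "\<And>j. j < L \<Longrightarrow> vs j \<in> V"
    and As: "\<And>j. j < L \<Longrightarrow> As j \<in> carrier_mat (d (vs j)) (d (vs j))" "\<And>j. j < L \<Longrightarrow> As j \<noteq> 1\<^sub>m (d (vs j))"
    and red: "\<And>i j. i < j \<Longrightarrow> j < L \<Longrightarrow> vs i = vs j \<Longrightarrow> \<exists>q. i < q \<and> q < j \<and> D (vs q) (vs i)"
    and L: "0 < L"
  shows "f L \<noteq> f 0"
proof -
  define x where "x = (\<lambda>p. idx (vs p))"
  \<comment> \<open>Heights are defined for letters that are natural numbers, so \<open>D\<close> is
    transported along \<open>idx\<close>; the restriction to \<open>V\<close> makes injectivity of
    \<open>idx\<close> available.\<close>
  define D' where "D' = (\<lambda>a b. \<exists>u\<in>V. \<exists>v\<in>V. a = idx u \<and> b = idx v \<and> D u v)"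
  define h where "h = height x D'"
  have D': "D' (x p) (x q) \<longleftrightarrow> D (vs p) (vs q)" if "p < L" "q < L" for p q
  proof
    assume "D' (x p) (x q)"
    then obtain u v where "u \<in> V" "v \<in> V" "idx (vs p) = idx u" "idx (vs q) = idx v" "D u v"
      unfolding D'_def x_def by blast
    then show "D (vs p) (vs q)" using vs that inj_onD[OF idx_inj] by metis
  next
    assume "D (vs p) (vs q)"
    then show "D' (x p) (x q)" using vs that unfolding D'_def x_def by blast
  qed
  have D'_sym: "D' b a" if "D' a b" for a b
    using that D_sym unfolding D'_def by blast
  have x_eq: "x p = x q \<longleftrightarrow> vs p = vs q" if "p < L" "q < L" for p q
    using inj_on_eq_iff[OF idx_inj vs[OF that(1)] vs[OF that(2)]] by (simp add: x_def)
  have reduced: "reduced_seq x D' L"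
    unfolding reduced_seq_def
  proof (intro allI impI)
    fix i j assume ij: "i < j" "j < L" "x i = x j"
    then obtain q where "i < q" "q < j" "D (vs q) (vs i)" using red[of i j] x_eq by auto
    with ij show "\<exists>q>i. q < j \<and> D' (x q) (x i)" using D'[of q i] by auto
  qed
  have h_inj: "inj_on h {..<L}"
    unfolding h_def by (rule height_inj_on[OF reduced D'_sym])
  have h_less: "h p < h q" if "p < q" "q < L" "vs p = vs q" for p q
    unfolding h_def by (rule height_less_same_letter[OF reduced D'_sym]) (use that x_eq in auto)
  have h_keys: "Poly_Mapping.keys (h p) \<subseteq> {..<r}" if "p < L" for p
    unfolding h_def by (rule keys_height) (use that vs idx_less x_def in auto)
  have h_pos: "0 < h p" for p
    unfolding h_def using expo_pos expo_le_height by (rule less_le_trans)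
  \<comment> \<open>The invariant after \<open>n\<close> steps. Only the last occurrence of
    \<open>v\<close> matters, since steps at other vertices do not touch its coordinates. These are
    bounded individually because the next step at \<open>v\<close> recombines them by a
    matrix.\<close>
  define state where "state = (\<lambda>n v. (\<forall>p<n. vs p \<noteq> v) \<and> (\<forall>l. f n (Some (v, l)) = 0) \<or>
    (\<exists>p<n. vs p = v \<and> (\<forall>q. p < q \<longrightarrow> q < n \<longrightarrow> vs q \<noteq> v) \<and> leads r (h p) (sigma v (f n)) \<and>
       (\<forall>l<d v. dominated r (h p) (f n (Some (v, l))))))"
  have "n \<le> L \<Longrightarrow> f n None = 1 \<and> (\<forall>v\<in>V. state n v)" for n
  proof (induction n)
    case 0
    show ?case by (simp add: f_0 state_def)
  next
    case (Suc j)
    then have j: "j < L" and g_None: "f j None = 1" and IH: "\<And>v. v \<in> V \<Longrightarrow> state j v" by auto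
    define v where "v = vs j"
    define g where "g = f j"
    have v: "v \<in> V" unfolding v_def by (rule vs[OF j])
    have f_Suc_j: "f (Suc j) = step v (As j) g" unfolding v_def g_def by (rule f_Suc[OF j])
    define preds where "preds = insert 0 (h ` {i. i < j \<and> D' (x i) (x j)})"
    have h_j: "h j = expo (idx v) 1 + Max preds"
      unfolding h_def preds_def by (subst height.simps) (simp add: x_def v_def)
    \<comment> \<open>The summands of \<open>tau v g\<close> have the heights of last occurrences as
      leading degrees. These are pairwise different by \<open>h_inj\<close>, so the largest one
      leads the sum.\<close>
    have tau_leads: "leads r (Max preds) (tau v g)"
    proof -
      define U where "U = {u \<in> V. D u v \<and> (\<exists>p<j. vs p = u)}"
      have finU: "finite U" unfolding U_def using finite_V by simp
      have "\<exists>p<j. vs p = u \<and> (\<forall>q. p < q \<longrightarrow> q < j \<longrightarrow> vs q \<noteq> u) \<and> leads r (h p) (sigma u g)" if "u \<in> U" for u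
        using IH[of u] that unfolding U_def state_def g_def by blast
      \<comment> \<open>\<open>P u\<close> is the last position of \<open>u\<close> before
        \<open>j\<close>.\<close>
      then obtain P where P: "\<And>u. u \<in> U \<Longrightarrow> P u < j" "\<And>u. u \<in> U \<Longrightarrow> vs (P u) = u"
        "\<And>u q. u \<in> U \<Longrightarrow> P u < q \<Longrightarrow> q < j \<Longrightarrow> vs q \<noteq> u" "\<And>u. u \<in> U \<Longrightarrow> leads r (h (P u)) (sigma u g)"
        by metis
      have "sigma u g = 0" if "u \<in> V" "D u v" "u \<notin> U" for u
        using IH[of u] that unfolding U_def state_def g_def sigma_def by fastforce
      then have "(\<Sum>u | u \<in> V \<and> D u v. sigma u g) = (\<Sum>u\<in>U. sigma u g)"
        using finite_V by (intro sum.mono_neutral_right) (auto simp: U_def)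
      then have tau: "tau v g = (\<Sum>u\<in>U. sigma u g) + 1"
        unfolding tau_def by (simp add: g_None g_def)
      \<comment> \<open>Among the occurrences of one vertex the last has the greatest height, so a
        maximum over all predecessors is attained at some \<open>P u\<close>.\<close>
      have pred_le: "\<exists>u\<in>U. h i \<le> h (P u)" if "i < j" "D' (x i) (x j)" for i
      proof -
        have "D (vs i) v" using D'[of i j] that j by (simp add: v_def)
        then have U: "vs i \<in> U" using vs[of i] that j by (auto simp: U_def)
        have "i \<le> P (vs i)" using P(3)[OF U, of i] that(1) by (cases "P (vs i) < i") auto
        then have "h i \<le> h (P (vs i))"
          using h_less[of i "P (vs i)"] P(1,2)[OF U] j by (cases "i = P (vs i)") auto
        with U show ?thesis by blast
      qed
      show ?thesis
      proof (cases "U = {}")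
        case True
        then have "preds = {0}" using pred_le by (auto simp: preds_def)
        then show ?thesis
          using leads_single[of "1::'a" r 0] by (simp add: tau True)
      next
        case False
        let ?m = "Max ((h \<circ> P) ` U)"
        have "?m \<in> (h \<circ> P) ` U" using finU False by (intro Max_in) auto
        then obtain u where u: "u \<in> U" "?m = h (P u)" by auto
        have m_ge: "h (P w) \<le> ?m" if "w \<in> U" for w using that finU by (intro Max_ge) auto
        have "leads r ?m (\<Sum>u\<in>U. sigma u g)"
        proof (rule leads_sum[OF finU False])
          show "inj_on (h \<circ> P) U"
          proof (rule comp_inj_on)
            show "inj_on P U" using P(2) by (metis inj_onI)
            show "inj_on h (P ` U)" by (rule inj_on_subset[OF h_inj]) (use P(1) j in fastforce)
          qed
          show "Poly_Mapping.keys ((h \<circ> P) w) \<subseteq> {..<r}" if "w \<in> U" for w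
            using h_keys[of "P w"] P(1)[OF that] j by simp
        qed (use P(4) in simp)
        \<comment> \<open>The constant 1 from the coordinate \<open>None\<close> has degree 0, below
          every height.\<close>
        then have "leads r ?m (tau v g)"
          unfolding tau
        proof (rule leads_add)
          show "dominated r 0 (1 :: 'a mpoly)" using dominated_single[of r 0 0 "1::'a"] by simp
          show "0 < ?m" "Poly_Mapping.keys ?m \<subseteq> {..<r}"
            using u(2) h_pos h_keys[of "P u"] P(1)[OF u(1)] j by simp_all
        qed simp
        moreover have "Max preds = ?m"
        proof (rule Max_eqI)
          show "finite preds" by (simp add: preds_def)
          have "D (vs (P u)) v" using u P(2) by (auto simp: U_def)
          then have "D' (x (P u)) (x j)" using D'[of "P u" j] P(1)[OF u(1)] j by (simp add: v_def)
          then show "?m \<in> preds" using u P(1) by (auto simp: preds_def)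
          fix a assume "a \<in> preds"
          then consider "a = 0" | i where "i < j" "D' (x i) (x j)" "a = h i" by (auto simp: preds_def)
          then show "a \<le> ?m"
          proof cases
            case 1
            then show ?thesis by (simp add: poly_mapping_nat_ge_0)
          next
            case (2 i)
            then obtain w where "w \<in> U" "h i \<le> h (P w)" using pred_le by blast
            then show ?thesis using m_ge 2 by (meson order_trans)
          qed
        qed
        ultimately show ?thesis by simp
      qed
    qed
    \<comment> \<open>\<open>b\<close> bounds the old coordinates of \<open>v\<close>: it is the
      height of the previous occurrence of \<open>v\<close>, or 0 if there is none.\<close>
    obtain b where b: "\<And>k. k < d v \<Longrightarrow> dominated r b (g (Some (v, k)))" "b < h j" "Poly_Mapping.keys b \<subseteq> {..<r}"
    proof (cases "\<exists>p<j. vs p = v")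
      case True
      then obtain p where p: "p < j" "vs p = v" "\<forall>l<d v. dominated r (h p) (g (Some (v, l)))"
        using IH[OF v] unfolding state_def g_def by blast
      show ?thesis
        by (rule that[of "h p"]) (use p j h_less[of p j] h_keys[of p] in \<open>auto simp: v_def\<close>)
    next
      case False
      then have "g (Some (v, l)) = 0" for l using IH[OF v] unfolding state_def g_def by blast
      then show ?thesis by (intro that[of 0]) (simp_all add: h_pos)
    qed
    have const: "dominated r 0 (const_poly c)" for c :: 'a
      using dominated_single[of r 0 0 c] by simp
    have scale: "dominated r a (p * q)" if "dominated r 0 p" "dominated r a q" for a and p q :: "'a mpoly"
      using dominated_mult[OF that] by simp
    have row: "dominated r b (\<Sum>k<d v. const_poly (As j $$ (l, k)) * g (Some (v, k)))" for l
      by (intro dominated_sum scale const b(1)) simp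
    have y: "dominated r 0 (Poly_Mapping.single (expo r e) c)" for e and c :: 'a
      using dominated_single[of r 0 e c] by simp
    have old: "dominated r b (\<Sum>l<d v. Poly_Mapping.single (expo r (l * d v)) 1 *
          (\<Sum>k<d v. const_poly (As j $$ (l, k)) * g (Some (v, k))))"
      by (intro dominated_sum scale y row)
    have "\<exists>l<d v. \<exists>k<d v. As j $$ (l, k) \<noteq> (if l = k then 1 else 0)"
    proof (rule ccontr)
      assume "\<not> ?thesis"
      then have "As j = 1\<^sub>m (d v)" using As(1)[OF j] by (intro eq_matI) (auto simp: v_def)
      with As(2)[OF j] show False by (simp add: v_def)
    qed
    then obtain l0 k0 where entry: "l0 < d v" "k0 < d v" "As j $$ (l0, k0) - (if l0 = k0 then 1 else 0) \<noteq> 0"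
      by (metis right_minus_eq)
    \<comment> \<open>The degrees of the three factors add up to \<open>h j\<close>: the middle one
      involves only the variable of index \<open>r\<close> and has degree 0, and
      \<open>tau v g\<close> has degree \<open>Max preds\<close>.\<close>
    have new: "leads r (h j) (Poly_Mapping.single (expo (idx v) 1) 1 *
       (\<Sum>l<d v. \<Sum>k<d v. Poly_Mapping.single (expo r (l * d v + k)) (As j $$ (l, k) - (if l = k then 1 else 0))) *
       tau v g)" (is "leads r _ (_ * ?B * _)")
    proof -
      have "leads r (expo (idx v) 1 + 0) (Poly_Mapping.single (expo (idx v) 1) 1 * ?B)"
        using entry by (intro leads_mult leads_single leads_entries) auto
      from leads_mult[OF this tau_leads] show ?thesis by (simp add: h_j)
    qed
    \<comment> \<open>The old part has degree at most \<open>b\<close>, strictly below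
      \<open>h j\<close>, so it cannot cancel the new leading term.\<close>
    have sigma_v: "leads r (h j) (sigma v (f (Suc j)))"
      unfolding f_Suc_j sigma_step_same
      by (subst add.commute) (rule leads_add[OF new old b(2) h_keys[OF j] b(3)])
    have shift: "dominated r (h j) (shift v g l)" for l
      unfolding shift_def h_j by (intro dominated_mult dominated_single leads_dominated tau_leads)
    have "dominated r (h j) (f (Suc j) (Some (v, l)))" if "l < d v" for l
    proof -
      have "dominated r (h j) (g (Some (v, k)) + shift v g k)" if "k < d v" for k
        using b(1)[OF that] b(2) shift by (meson dominated_add dominated_mono less_imp_le)
      then have "dominated r (h j) (\<Sum>k<d v. const_poly (As j $$ (l, k)) * (g (Some (v, k)) + shift v g k))"
        by (intro dominated_sum scale const) simp
      then show ?thesis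
        unfolding f_Suc_j step_same[OF that] by (intro dominated_diff shift)
    qed
    then have "state (Suc j) v"
      unfolding state_def using sigma_v by (intro disjI2 exI[of _ j]) (auto simp: v_def)
    moreover have "state (Suc j) u" if u: "u \<in> V" "u \<noteq> v" for u
    proof -
      have "f (Suc j) (Some (u, l)) = f j (Some (u, l))" "sigma u (f (Suc j)) = sigma u (f j)" for l
        using u by (simp_all add: f_Suc_j g_def sigma_step_other)
      moreover have "vs j \<noteq> u" using u by (simp add: v_def)
      ultimately show ?thesis
        using IH[OF u(1)] unfolding state_def less_Suc_eq by metis
    qed
    moreover have "f (Suc j) None = 1" by (simp add: f_Suc_j g_def g_None)
    ultimately show ?case by blast
  qed
  from this[of L] have state: "state L (vs (L - 1))" using vs[of "L - 1"] L by simp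
  have "L - 1 < L" using L by simp
  then obtain p where "leads r (h p) (sigma (vs (L - 1)) (f L))"
    using state unfolding state_def by blast
  then have "sigma (vs (L - 1)) (f L) \<noteq> 0" by (rule leads_nonzero)
  moreover have "sigma (vs (L - 1)) (f 0) = 0" by (simp add: f_0 sigma_def)
  ultimately show ?thesis by metis
qed

end

section \<open>Matrices of the operators\<close>

context vertex_rep
begin

text \<open>The head of the list acts last, so that concatenation of words is composition of
  operators.\<close>

definition act ::
  "('v \<times> 'a mat) list \<Rightarrow> (('v \<times> nat) option \<Rightarrow> 'a mpoly) \<Rightarrow> (('v \<times> nat) option \<Rightarrow> 'a::ring_1 mpoly)" where
  "act w f = foldr (\<lambda>(v, A). step v A) w f"

lemma act_Nil [simp]: "act [] f = f"
  by (simp add: act_def)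

lemma act_Cons [simp]: "act ((v, A) # w) f = step v A (act w f)"
  by (simp add: act_def)

lemma act_append: "act (u @ w) f = act u (act w f)"
  by (simp add: act_def)

lemma act_add: "act w (\<lambda>i. f i + g i) = (\<lambda>i. act w f i + act w g i)"
  by (induction w) (auto simp: step_add)

lemma act_scale: "act w (\<lambda>i. f i * c) = (\<lambda>i. act w f i * c)"
  by (induction w) (auto simp: step_scale)

lemma act_zero: "act w (\<lambda>i. 0) = (\<lambda>i. 0)"
  using act_scale[of w "\<lambda>i. 0" 0] by simp

lemma act_sum: "finite I \<Longrightarrow> act w (\<lambda>i. \<Sum>j\<in>I. f j i * c j) = (\<lambda>i. \<Sum>j\<in>I. act w (f j) i * c j)"
  by (induction I rule: finite_induct) (simp_all add: act_zero act_add act_scale)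

definition unit :: "'i \<Rightarrow> 'i \<Rightarrow> 'a::ring_1 mpoly" where
  "unit j = (\<lambda>i. if i = j then 1 else 0)"

lemma act_poly_vars:
  assumes "fst ` set w \<subseteq> V"
  shows "act w (unit j) i \<in> poly_vars (Suc r)"
  using assms
proof (induction w arbitrary: i)
  case Nil
  then show ?case by (simp add: unit_def poly_vars_0 poly_vars_1)
next
  case (Cons x w)
  then show ?case by (cases x) (auto intro!: step_poly_vars)
qed

lemma act_support:
  assumes "fst ` set w \<subseteq> V" "j \<in> coords" "i \<notin> coords"
  shows "act w (unit j) i = 0"
  using assms
proof (induction w arbitrary: i)
  case Nil
  then show ?case by (auto simp: unit_def)
next
  case (Cons x w)
  then show ?case by (cases x) (auto intro!: step_support)
qed

definition dim :: nat where
  "dim = card coords"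

definition coord :: "nat \<Rightarrow> ('v \<times> nat) option" where
  "coord = (SOME e. bij_betw e {..<dim} coords)"

lemma bij_betw_coord: "bij_betw coord {..<dim} coords"
  unfolding coord_def dim_def
  using someI_ex[OF ex_bij_betw_nat_finite[OF finite_coords]] by (simp add: lessThan_atLeast0)

lemma dim_ge_1: "1 \<le> dim"
  unfolding dim_def using finite_coords card_gt_0_iff[of coords] by (auto simp: coords_def)

definition rep :: "('v \<times> 'a mat) list \<Rightarrow> 'a::ring_1 mpoly mat" where
  "rep w = mat dim dim (\<lambda>(a, b). act w (unit (coord b)) (coord a))"

lemma rep_carrier: "fst ` set w \<subseteq> V \<Longrightarrow> rep w \<in> carrier (matrix_ring dim (poly_vars (Suc r)))"
  by (auto simp: matrix_ring_def ring_mat_def rep_def elements_mat_subset_iff[of _ dim dim] act_poly_vars)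

lemma rep_Nil: "rep [] = 1\<^sub>m dim"
proof (rule eq_matI)
  fix a b assume ab: "a < dim_row (1\<^sub>m dim :: 'a mpoly mat)" "b < dim_col (1\<^sub>m dim :: 'a mpoly mat)"
  then have "coord a = coord b \<longleftrightarrow> a = b"
    using bij_betw_coord by (auto simp: bij_betw_def inj_on_eq_iff)
  with ab show "rep [] $$ (a, b) = (1\<^sub>m dim :: 'a mpoly mat) $$ (a, b)"
    by (simp add: rep_def unit_def)
qed (simp_all add: rep_def)

text \<open>By right linearity, the action of \<open>u\<close> on the column
  \<open>act w (unit (coord b))\<close> is determined by the images of the basis vectors; this
  column vanishes outside \<open>coords\<close>, which makes the expansion finite.\<close>

lemma rep_append:
  assumes "fst ` set w \<subseteq> V"
  shows "rep (u @ w) = rep u * rep w"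
proof (rule eq_matI)
  fix a b assume "a < dim_row (rep u * rep w)" "b < dim_col (rep u * rep w)"
  then have ab: "a < dim" "b < dim" by (simp_all add: rep_def)
  define f where "f = act w (unit (coord b))"
  have "coord b \<in> coords" using ab bij_betw_coord by (auto simp: bij_betw_def)
  then have supp: "f i = 0" if "i \<notin> coords" for i
    unfolding f_def using assms that by (intro act_support)
  have "f = (\<lambda>i. \<Sum>j\<in>coords. unit j i * f j)"
  proof
    fix i
    have "(\<Sum>j\<in>coords. unit j i * f j) = (\<Sum>j\<in>coords. if i = j then f j else 0)"
      by (intro sum.cong) (auto simp: unit_def)
    then show "f i = (\<Sum>j\<in>coords. unit j i * f j)" using finite_coords supp by simp
  qed
  then have "act u f = (\<lambda>i. \<Sum>j\<in>coords. act u (unit j) i * f j)"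
    using act_sum[OF finite_coords, of u unit f] by simp
  then have "rep (u @ w) $$ (a, b) = (\<Sum>j\<in>coords. act u (unit j) (coord a) * f j)"
    using ab by (simp add: rep_def act_append f_def)
  also have "\<dots> = (\<Sum>k<dim. act u (unit (coord k)) (coord a) * f (coord k))"
    by (rule sum.reindex_bij_betw[OF bij_betw_coord, symmetric])
  also have "\<dots> = (rep u * rep w) $$ (a, b)"
    using ab by (subst mat_mult_entry[of _ dim]) (auto simp: rep_def f_def)
  finally show "rep (u @ w) $$ (a, b) = (rep u * rep w) $$ (a, b)" .
qed (simp_all add: rep_def)

text \<open>Only the column of \<open>None\<close> is read off, because faithfulness is tested on
  that basis vector. Outside \<open>coords\<close> both sides vanish.\<close>

lemma rep_eq_one_imp:
  fixes w :: "('v \<times> 'a::ring_1 mat) list"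
  assumes "fst ` set w \<subseteq> V" "rep w = 1\<^sub>m dim"
  shows "act w (unit None) = unit None"
proof
  fix i
  have None: "None \<in> coords" by (simp add: coords_def)
  show "act w (unit None) i = unit None i"
  proof (cases "i \<in> coords")
    case True
    have "coord ` {..<dim} = coords" using bij_betw_coord by (simp add: bij_betw_def)
    with True None have "i \<in> coord ` {..<dim}" "None \<in> coord ` {..<dim}" by simp_all
    then obtain a b where ab: "a < dim" "b < dim" "coord a = i" "coord b = None"
      by (auto elim!: imageE)
    have "rep w $$ (a, b) = rep ([] :: ('v \<times> 'a mat) list) $$ (a, b)" by (simp add: assms rep_Nil)
    with ab show ?thesis by (simp add: rep_def)
  next
    case False
    with None have "i \<noteq> None" by metis
    then show ?thesis using act_support[OF assms(1) None False] by (simp add: unit_def)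
  qed
qed

definition reduced_word :: "('v \<times> 'a::ring_1 mat) list \<Rightarrow> bool" where
  "reduced_word w \<longleftrightarrow> (\<forall>(v, A) \<in> set w. A \<noteq> 1\<^sub>m (d v)) \<and>
     (\<forall>i j. i < j \<longrightarrow> j < length w \<longrightarrow> fst (w ! i) = fst (w ! j) \<longrightarrow>
       (\<exists>q. i < q \<and> q < j \<and> D (fst (w ! q)) (fst (w ! i))))"

lemma act_reduced_word:
  fixes w :: "('v \<times> 'a::ring_1_no_zero_divisors mat) list"
  assumes w: "\<And>v A. (v, A) \<in> set w \<Longrightarrow> v \<in> V \<and> A \<in> carrier_mat (d v) (d v)"
    and red: "reduced_word w" and ne: "w \<noteq> []"
  shows "act w (unit None) \<noteq> unit None"
proof -
  define L where "L = length w"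
  \<comment> \<open>The last letter of \<open>w\<close> acts first, so step \<open>n\<close> of the
    orbit uses position \<open>L - Suc n\<close>; reversing a word keeps it reduced.\<close>
  define f where "f n = act (drop (L - n) w) (unit None)" for n
  define vs where "vs n = fst (w ! (L - Suc n))" for n
  define As where "As n = snd (w ! (L - Suc n))" for n
  have mem: "(vs n, As n) \<in> set w" if "n < L" for n
    using that by (simp add: vs_def As_def L_def)
  have "f L \<noteq> f 0"
  proof (rule orbit_nontrivial)
    show "f 0 = (\<lambda>i. if i = None then 1 else 0)" by (simp add: f_def L_def unit_def)
    fix j assume j: "j < L"
    then have "drop (L - Suc j) w = w ! (L - Suc j) # drop (Suc (L - Suc j)) w"
      by (intro Cons_nth_drop_Suc[symmetric]) (simp add: L_def)
    moreover have "Suc (L - Suc j) = L - j" using j by simp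
    ultimately have "drop (L - Suc j) w = (vs j, As j) # drop (L - j) w"
      by (simp add: vs_def As_def)
    then show "f (Suc j) = step (vs j) (As j) (f j)" by (simp add: f_def)
    show "vs j \<in> V" "As j \<in> carrier_mat (d (vs j)) (d (vs j))" using w mem[OF j] by auto
    show "As j \<noteq> 1\<^sub>m (d (vs j))" using red mem[OF j] unfolding reduced_word_def by blast
  next
    fix i j assume ij: "i < j" "j < L" "vs i = vs j"
    then have "L - Suc j < L - Suc i" "L - Suc i < length w" by (simp_all add: L_def)
    then obtain q where q: "L - Suc j < q" "q < L - Suc i" "D (fst (w ! q)) (vs j)"
      using red ij(3) unfolding reduced_word_def vs_def by metis
    then have "i < L - Suc q" "L - Suc q < j" "L - Suc (L - Suc q) = q" using ij by auto
    with q(3) ij(3) show "\<exists>q>i. q < j \<and> D (vs q) (vs i)"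
      unfolding vs_def by metis
  qed (use ne in \<open>simp add: L_def\<close>)
  then show ?thesis by (simp add: f_def L_def)
qed

end

section \<open>The graph product\<close>

lemma general_linear_simps:
  "x \<otimes>\<^bsub>general_linear n S\<^esub> y = x * y" "\<one>\<^bsub>general_linear n S\<^esub> = 1\<^sub>m n"
  "carrier (general_linear n S) = Units (matrix_ring n S)"
  by (simp_all add: general_linear_def units_of_def matrix_ring_def ring_mat_def)

lemma linear_over_faithful_rep:
  fixes G :: "('g, 'm) monoid_scheme"
  assumes "linear_over (UNIV :: 'a::ring_1 set) G" "group G"
  obtains n and M :: "'g \<Rightarrow> 'a::ring_1 mat" where "\<And>g. g \<in> carrier G \<Longrightarrow> M g \<in> carrier_mat n n"
    "\<And>g h. g \<in> carrier G \<Longrightarrow> h \<in> carrier G \<Longrightarrow> M (g \<otimes>\<^bsub>G\<^esub> h) = M g * M h"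
    "M \<one>\<^bsub>G\<^esub> = 1\<^sub>m n" "\<And>g. g \<in> carrier G \<Longrightarrow> M g = 1\<^sub>m n \<Longrightarrow> g = \<one>\<^bsub>G\<^esub>"
proof -
  obtain n H where H: "subgroup H (general_linear n (UNIV :: 'a set))"
    and "G \<cong> (general_linear n (UNIV :: 'a set))\<lparr>carrier := H\<rparr>"
    using assms unfolding linear_over_def by blast
  then obtain M where M: "M \<in> iso G ((general_linear n (UNIV :: 'a set))\<lparr>carrier := H\<rparr>)"
    unfolding is_iso_def by blast
  interpret GL: group "general_linear n (UNIV :: 'a set)" by (rule group_general_linear_UNIV)
  interpret G: group G by fact
  interpret M: group_hom G "(general_linear n (UNIV :: 'a set))\<lparr>carrier := H\<rparr>" M
    using M GL.subgroup_imp_group[OF H] assms by (simp add: group_hom_def group_hom_axioms_def iso_def)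
  have one: "M \<one>\<^bsub>G\<^esub> = 1\<^sub>m n" using M.hom_one by (simp add: general_linear_simps)
  show thesis
  proof (rule that[of M n])
    fix g assume g: "g \<in> carrier G"
    then have "M g \<in> H" using M.hom_closed by simp
    then have "M g \<in> carrier (general_linear n (UNIV :: 'a set))" using subgroup.subset[OF H] by blast
    then have "M g \<in> carrier (matrix_ring n (UNIV :: 'a set))" by (simp add: general_linear_simps Units_def)
    then show "M g \<in> carrier_mat n n" by (simp add: matrix_ring_def)
    show "g = \<one>\<^bsub>G\<^esub>" if "M g = 1\<^sub>m n"
    proof (rule inj_onD[of M "carrier G"])
      show "inj_on M (carrier G)" using M by (simp add: iso_def bij_betw_def)
    qed (simp_all add: that g general_linear_simps)
    show "M (g \<otimes>\<^bsub>G\<^esub> h) = M g * M h" if "h \<in> carrier G" for h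
      using M.hom_mult[OF g that] by (simp add: general_linear_simps)
  qed (rule one)
qed

locale graph_product_rep = group_family V G +
  vertex_rep V "\<lambda>u v. u \<noteq> v \<and> {u, v} \<notin> E" idx d r
  for V :: "'v set" and G :: "'v \<Rightarrow> ('g, 'm) monoid_scheme" and E :: "'v set set"
    and idx :: "'v \<Rightarrow> nat" and d :: "'v \<Rightarrow> nat" and r :: nat +
  fixes M :: "'v \<Rightarrow> 'g \<Rightarrow> 'a::ring_1_no_zero_divisors mat"
  assumes graph: "simplicial_graph V E"
    and M_carrier: "v \<in> V \<Longrightarrow> g \<in> carrier (G v) \<Longrightarrow> M v g \<in> carrier_mat (d v) (d v)"
    and M_mult: "v \<in> V \<Longrightarrow> g \<in> carrier (G v) \<Longrightarrow> h \<in> carrier (G v) \<Longrightarrow>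
      M v (g \<otimes>\<^bsub>G v\<^esub> h) = M v g * M v h"
    and M_one: "v \<in> V \<Longrightarrow> M v \<one>\<^bsub>G v\<^esub> = 1\<^sub>m (d v)"
    and M_faithful: "v \<in> V \<Longrightarrow> g \<in> carrier (G v) \<Longrightarrow> M v g = 1\<^sub>m (d v) \<Longrightarrow> g = \<one>\<^bsub>G v\<^esub>"
begin

abbreviation "F \<equiv> free_product V G"
abbreviation "N \<equiv> normal_closure F (graph_relators V E G)"
abbreviation "cls w \<equiv> fp_rel V G `` {w}"
abbreviation "GL \<equiv> general_linear dim (poly_vars (Suc r) :: 'a mpoly set)"

section \<open>The matrix representation of the free product\<close>

definition enc :: "('v \<times> 'g) list \<Rightarrow> ('v \<times> 'a mat) list" where
  "enc w = map (\<lambda>(v, g). (v, M v g)) w"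

lemma enc_simps [simp]: "enc [] = []" "enc ((v, g) # w) = (v, M v g) # enc w"
  "enc (u @ w) = enc u @ enc w"
  by (simp_all add: enc_def)

lemma fst_enc: "w \<in> fp_words V G \<Longrightarrow> fst ` set (enc w) \<subseteq> V"
  by (auto simp: enc_def fp_words_def)

lemma act_enc_rel: "(u, w) \<in> fp_rel V G \<Longrightarrow> act (enc u) f = act (enc w) f"
proof (induction rule: fp_rel.induct)
  case (one a b v)
  then show ?case by (simp add: act_append M_one step_one)
next
  case (mult a b v g h)
  then show ?case by (simp add: act_append M_mult M_carrier step_mult)
qed auto

lemma rep_enc_rel: "(u, w) \<in> fp_rel V G \<Longrightarrow> rep (enc u) = rep (enc w)"
  unfolding rep_def by (simp add: act_enc_rel)

text \<open>All words of a class give the same matrix, by \<open>rep_enc_rel\<close>, so the image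
  of a class is a singleton.\<close>

definition hom_rep :: "('v \<times> 'g) list set \<Rightarrow> 'a mpoly mat" where
  "hom_rep x = the_elem ((\<lambda>w. rep (enc w)) ` x)"

lemma hom_rep_cls: "w \<in> fp_words V G \<Longrightarrow> hom_rep (cls w) = rep (enc w)"
proof -
  assume "w \<in> fp_words V G"
  then have "w \<in> cls w" by (simp add: fp_rel.refl)
  then have "(\<lambda>w. rep (enc w)) ` cls w = {rep (enc w)}" by (auto dest: rep_enc_rel)
  then show ?thesis by (simp add: hom_rep_def)
qed

lemma one_free_product: "\<one>\<^bsub>F\<^esub> = cls []"
  by (simp add: free_product_def)

text \<open>A word representing the inverse in the free product gives the inverse matrix, whose
  entries are therefore polynomials as well.\<close>

lemma rep_enc_GL:
  assumes "w \<in> fp_words V G"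
  shows "rep (enc w) \<in> carrier GL"
proof -
  interpret F: group F by (rule group_free_product)
  have cw: "cls w \<in> carrier F" by (rule free_product_carrierI[OF assms])
  obtain w' where w': "w' \<in> fp_words V G" "inv\<^bsub>F\<^esub> cls w = cls w'"
    using F.inv_closed[OF cw] by (rule free_product_carrierE)
  have "hom_rep (cls (w' @ w)) = hom_rep (cls [])" "hom_rep (cls (w @ w')) = hom_rep (cls [])"
    using F.l_inv[OF cw] F.r_inv[OF cw] assms w' by (simp_all add: free_product_mult one_free_product)
  then have "rep (enc w') * rep (enc w) = 1\<^sub>m dim" "rep (enc w) * rep (enc w') = 1\<^sub>m dim"
    using assms w' by (simp_all add: hom_rep_cls fp_words_simps rep_append fst_enc rep_Nil)
  moreover have "rep (enc w) \<in> carrier (matrix_ring dim (poly_vars (Suc r)))"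
    "rep (enc w') \<in> carrier (matrix_ring dim (poly_vars (Suc r)))"
    using assms w' by (simp_all add: rep_carrier fst_enc)
  ultimately show ?thesis
    unfolding general_linear_simps Units_def by (auto simp: matrix_ring_def ring_mat_def)
qed

lemma group_hom_rep: "group_hom F GL hom_rep"
  unfolding group_hom_def group_hom_axioms_def
proof (intro conjI group_free_product group_general_linear_poly_vars homI)
  fix x y assume x: "x \<in> carrier F" and y: "y \<in> carrier F"
  obtain u where u: "u \<in> fp_words V G" "x = cls u" using x by (rule free_product_carrierE)
  obtain w where w: "w \<in> fp_words V G" "y = cls w" using y by (rule free_product_carrierE)
  show "hom_rep x \<in> carrier GL" using u by (simp add: hom_rep_cls rep_enc_GL)
  show "hom_rep (x \<otimes>\<^bsub>F\<^esub> y) = hom_rep x \<otimes>\<^bsub>GL\<^esub> hom_rep y"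
    using u w by (simp add: free_product_mult hom_rep_cls fp_words_simps rep_append fst_enc general_linear_simps)
qed

lemma edge_vertices: "{v, u} \<in> E \<Longrightarrow> v \<in> V \<and> u \<in> V \<and> v \<noteq> u"
  using graph by (force simp: simplicial_graph_def)

lemma normal_N: "N \<lhd> F"
  by (intro group.normal_normal_closure group_free_product graph_relators_carrier graph)

text \<open>The kernel is a normal subgroup and contains every relator because the operators of
  adjacent vertices commute; \<open>N\<close> lies in every such subgroup.\<close>

lemma normal_closure_subset_kernel: "N \<subseteq> kernel F GL hom_rep"
proof -
  interpret \<Phi>: group_hom F GL hom_rep by (rule group_hom_rep)
  have "graph_relators V E G \<subseteq> kernel F GL hom_rep"
  proof
    fix c assume c: "c \<in> graph_relators V E G"
    then obtain v u g h where e: "{v, u} \<in> E" and g: "g \<in> carrier (G v)" and h: "h \<in> carrier (G u)"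
      and ceq: "c = commutator F (cls [(v, g)]) (cls [(u, h)])"
      unfolding graph_relators_def fp_incl_def by blast
    have V: "v \<in> V" "u \<in> V" "v \<noteq> u" using edge_vertices[OF e] by auto
    let ?x = "cls [(v, g)]" and ?y = "cls [(u, h)]"
    have words: "[(v, g)] \<in> fp_words V G" "[(u, h)] \<in> fp_words V G"
      using V g h by (simp_all add: fp_words_simps)
    then have xy: "?x \<in> carrier F" "?y \<in> carrier F" by (simp_all add: free_product_carrierI)
    have "rep (enc [(v, g), (u, h)]) = rep (enc [(u, h), (v, g)])"
      unfolding rep_def using V e by (simp add: step_commute[of v u])
    then have "hom_rep (?x \<otimes>\<^bsub>F\<^esub> ?y) = hom_rep (?y \<otimes>\<^bsub>F\<^esub> ?x)"
      using words by (simp add: free_product_mult hom_rep_cls fp_words_simps)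
    then have "hom_rep ?x \<otimes>\<^bsub>GL\<^esub> hom_rep ?y = hom_rep ?y \<otimes>\<^bsub>GL\<^esub> hom_rep ?x"
      using xy by simp
    then have "hom_rep c = \<one>\<^bsub>GL\<^esub>"
      unfolding ceq commutator_def using xy
      by (simp add: \<Phi>.H.m_assoc \<Phi>.H.inv_solve_right)
    with c show "c \<in> kernel F GL hom_rep"
      using graph_relators_carrier[OF graph] by (auto simp: kernel_def)
  qed
  then show ?thesis
    using \<Phi>.normal_kernel unfolding normal_closure_def by blast
qed

section \<open>Reduction of words modulo the commutation relations\<close>

abbreviation "coset w \<equiv> N #>\<^bsub>F\<^esub> cls w"

lemma group_hom_coset: "group_hom F (graph_product V E G) (\<lambda>x. N #>\<^bsub>F\<^esub> x)"
  unfolding graph_product_def group_hom_def group_hom_axioms_def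
  using normal.r_coset_hom_Mod[OF normal_N] normal.factorgroup_is_group[OF normal_N] group_free_product
  by blast

lemma coset_append:
  assumes "u \<in> fp_words V G" "w \<in> fp_words V G"
  shows "coset (u @ w) = coset u \<otimes>\<^bsub>graph_product V E G\<^esub> coset w"
proof -
  interpret \<pi>: group_hom F "graph_product V E G" "\<lambda>x. N #>\<^bsub>F\<^esub> x" by (rule group_hom_coset)
  show ?thesis
    using \<pi>.hom_mult[of "cls u" "cls w"] assms by (simp add: free_product_carrierI free_product_mult)
qed

lemma coset_rel: "(u, w) \<in> fp_rel V G \<Longrightarrow> coset u = coset w"
  using equiv_class_eq[OF equiv_fp_rel] by metis

lemma coset_context:
  assumes "coset u = coset w" "u \<in> fp_words V G" "w \<in> fp_words V G" "a \<in> fp_words V G" "b \<in> fp_words V G"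
  shows "coset (a @ u @ b) = coset (a @ w @ b)"
  using assms by (simp add: coset_append fp_words_simps)

lemma coset_swap:
  assumes e: "{v, u} \<in> E" and g: "g \<in> carrier (G v)" and h: "h \<in> carrier (G u)"
  shows "coset [(v, g), (u, h)] = coset [(u, h), (v, g)]"
proof -
  interpret \<pi>: group_hom F "graph_product V E G" "\<lambda>x. N #>\<^bsub>F\<^esub> x" by (rule group_hom_coset)
  have V: "v \<in> V" "u \<in> V" using edge_vertices[OF e] by auto
  let ?x = "cls [(v, g)]" and ?y = "cls [(u, h)]"
  have words: "[(v, g)] \<in> fp_words V G" "[(u, h)] \<in> fp_words V G"
    using V g h by (simp_all add: fp_words_simps)
  then have xy: "?x \<in> carrier F" "?y \<in> carrier F" by (simp_all add: free_product_carrierI)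
  define c where "c = commutator F ?x ?y"
  have c: "c \<in> carrier F" unfolding c_def commutator_def using xy by simp
  have "c \<in> graph_relators V E G"
    unfolding graph_relators_def fp_incl_def c_def using e g h by blast
  then have "c \<in> N" unfolding normal_closure_def by blast
  \<comment> \<open>The commutator \<open>c\<close> turns the product of \<open>?y\<close> and
    \<open>?x\<close> into that of \<open>?x\<close> and \<open>?y\<close>; as it lies in
    \<open>N\<close>, both have the same coset.\<close>
  have "c \<otimes>\<^bsub>F\<^esub> (?y \<otimes>\<^bsub>F\<^esub> ?x) = ?x \<otimes>\<^bsub>F\<^esub> ?y"
    unfolding c_def commutator_def using xy
    by (simp add: \<pi>.G.m_assoc \<pi>.G.inv_solve_left' flip: \<pi>.G.m_assoc[of "inv\<^bsub>F\<^esub> ?y"] \<pi>.G.m_assoc[of "inv\<^bsub>F\<^esub> ?x"])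
  then have "N #>\<^bsub>F\<^esub> (?x \<otimes>\<^bsub>F\<^esub> ?y) = (N #>\<^bsub>F\<^esub> c) #>\<^bsub>F\<^esub> (?y \<otimes>\<^bsub>F\<^esub> ?x)"
    using xy c normal_imp_subgroup[OF normal_N] by (simp add: \<pi>.G.coset_mult_assoc subgroup.subset)
  also have "N #>\<^bsub>F\<^esub> c = N"
    using \<open>c \<in> N\<close> normal_imp_subgroup[OF normal_N] c by (simp add: \<pi>.G.coset_join2)
  finally show ?thesis using words by (simp add: free_product_mult)
qed

lemma coset_move:
  assumes "v \<in> V" "g \<in> carrier (G v)" "b \<in> fp_words V G" "\<And>x. x \<in> set b \<Longrightarrow> {v, fst x} \<in> E"
  shows "coset ((v, g) # b) = coset (b @ [(v, g)])"
  using assms(3,4)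
proof (induction b)
  case (Cons x b)
  obtain u h where x: "x = (u, h)" by (cases x)
  have e: "{v, u} \<in> E" using Cons.prems(2)[of x] x by simp
  have h: "u \<in> V" "h \<in> carrier (G u)" "b \<in> fp_words V G" using Cons.prems x by (auto simp: fp_words_simps)
  have "coset ([] @ [(v, g), (u, h)] @ b) = coset ([] @ [(u, h), (v, g)] @ b)"
    using e assms h by (intro coset_context coset_swap) (simp_all add: fp_words_simps)
  also have "\<dots> = coset ([(u, h)] @ ((v, g) # b) @ [])" by simp
  also have "\<dots> = coset ([(u, h)] @ (b @ [(v, g)]) @ [])"
    using Cons assms h by (intro coset_context) (simp_all add: fp_words_simps)
  finally show ?case by (simp add: x)
qed simp

text \<open>A word fails to be reduced for one of two reasons. A letter with trivial matrix is
  trivial by faithfulness and can be deleted. Two letters of one vertex, separated only by letters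
  of that vertex or of its neighbours, allow two of its letters to be moved together and
  multiplied.\<close>

lemma shorter_word:
  assumes w: "w \<in> fp_words V G" and not_red: "\<not> reduced_word (enc w)"
  shows "\<exists>w' \<in> fp_words V G. length w' < length w \<and> coset w' = coset w"
proof -
  have len: "length (enc w) = length w" by (simp add: enc_def)
  have nth: "fst (enc w ! i) = fst (w ! i)" if "i < length w" for i
    using that by (simp add: enc_def split_beta)
  consider v g where "(v, g) \<in> set w" "M v g = 1\<^sub>m (d v)" |
    i j where "i < j" "j < length w" "fst (w ! i) = fst (w ! j)"
      "\<And>q. i < q \<Longrightarrow> q < j \<Longrightarrow> fst (w ! q) = fst (w ! i) \<or> {fst (w ! q), fst (w ! i)} \<in> E"
  proof -
    have "(\<exists>(v, A) \<in> set (enc w). A = 1\<^sub>m (d v)) \<or>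
       (\<exists>i j. i < j \<and> j < length w \<and> fst (enc w ! i) = fst (enc w ! j) \<and>
         (\<forall>q. i < q \<longrightarrow> q < j \<longrightarrow> fst (enc w ! q) = fst (enc w ! i) \<or> {fst (enc w ! q), fst (enc w ! i)} \<in> E))"
      using not_red unfolding reduced_word_def len by blast
    then show thesis
    proof
      assume "\<exists>(v, A) \<in> set (enc w). A = 1\<^sub>m (d v)"
      then show thesis using that(1) by (auto simp: enc_def)
    next
      assume "\<exists>i j. i < j \<and> j < length w \<and> fst (enc w ! i) = fst (enc w ! j) \<and>
         (\<forall>q. i < q \<longrightarrow> q < j \<longrightarrow> fst (enc w ! q) = fst (enc w ! i) \<or> {fst (enc w ! q), fst (enc w ! i)} \<in> E)"
      then obtain i j where ij: "i < j" "j < length w" "fst (enc w ! i) = fst (enc w ! j)"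
        and adj: "\<And>q. i < q \<Longrightarrow> q < j \<Longrightarrow>
          fst (enc w ! q) = fst (enc w ! i) \<or> {fst (enc w ! q), fst (enc w ! i)} \<in> E"
        by blast
      show thesis
      proof (rule that(2)[of i j])
        show "fst (w ! i) = fst (w ! j)" using ij nth by simp
        show "fst (w ! q) = fst (w ! i) \<or> {fst (w ! q), fst (w ! i)} \<in> E" if "i < q" "q < j" for q
          using adj[OF that] ij that nth by simp
      qed (use ij in simp_all)
    qed
  qed
  then show ?thesis
  proof cases
    case (1 v g)
    obtain a b where ab: "w = a @ (v, g) # b" using split_list[OF 1(1)] by blast
    then have v: "v \<in> V" "g \<in> carrier (G v)" "a \<in> fp_words V G" "b \<in> fp_words V G"
      using w by (simp_all add: fp_words_simps)
    then have "g = \<one>\<^bsub>G v\<^esub>" using M_faithful 1 by blast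
    then have "(w, a @ b) \<in> fp_rel V G" using fp_rel.one[OF v(3,4,1)] by (simp add: ab)
    then have "coset (a @ b) = coset w" using coset_rel by metis
    then show ?thesis using v ab by (intro bexI[of _ "a @ b"]) (simp_all add: fp_words_simps)
  next
    case (2 i j)
    define v where "v = fst (w ! i)"
    define g where "g = snd (w ! i)"
    define a where "a = take i w"
    define t where "t = drop (Suc i) w"
    have "w = take i w @ w ! i # drop (Suc i) w" using 2 by (intro id_take_nth_drop) simp
    then have w_eq: "w = a @ (v, g) # t" by (simp add: a_def v_def g_def t_def)
    have tj: "t ! (j - Suc i) = w ! j" "j - Suc i < length t" using 2 by (auto simp: t_def)
    then have "\<exists>x\<in>set t. fst x = v" using 2(3) by (auto simp: v_def intro!: bexI[of _ "w ! j"])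
      (metis nth_mem)
    \<comment> \<open>The next occurrence of \<open>v\<close> after \<open>i\<close> is taken in
      place of \<open>j\<close>, so that \<open>b\<close> contains no letter of \<open>v\<close> and
      all its letters belong to neighbours of \<open>v\<close>.\<close>
    then obtain b x c where t_eq: "t = b @ x # c" and x: "fst x = v" and b: "\<forall>y\<in>set b. fst y \<noteq> v"
      using split_list_first_prop[of t "\<lambda>x. fst x = v"] by blast
    have lb: "length b \<le> j - Suc i"
    proof (rule ccontr)
      assume "\<not> length b \<le> j - Suc i"
      then have "t ! (j - Suc i) \<in> set b" by (simp add: t_eq nth_append)
      then show False using b tj 2(3) by (auto simp: v_def)
    qed
    have adj: "{v, fst y} \<in> E" if yb: "y \<in> set b" for y
    proof -
      obtain k where k: "k < length b" "y = b ! k" using yb by (auto simp: in_set_conv_nth)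
      then have "y = t ! k" by (simp add: t_eq nth_append)
      then have y: "y = w ! (Suc i + k)" using 2 by (simp add: t_def)
      have "fst (w ! (Suc i + k)) = v \<or> {fst (w ! (Suc i + k)), v} \<in> E"
        unfolding v_def using k lb by (intro 2(4)) simp_all
      then show ?thesis using b yb unfolding y[symmetric] by (auto simp: insert_commute)
    qed
    define h where "h = snd x"
    have x_eq: "x = (v, h)" using x by (simp add: h_def prod_eq_iff)
    have w_eq: "w = a @ (v, g) # b @ (v, h) # c" using w_eq t_eq x_eq by simp
    then have mem: "v \<in> V" "g \<in> carrier (G v)" "h \<in> carrier (G v)"
      "a \<in> fp_words V G" "b \<in> fp_words V G" "c \<in> fp_words V G"
      using w by (simp_all add: fp_words_simps)
    interpret Gv: group "G v" using groups mem by blast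
    have "coset w = coset (a @ ((v, g) # b) @ ((v, h) # c))" by (simp add: w_eq)
    also have "\<dots> = coset (a @ (b @ [(v, g)]) @ ((v, h) # c))"
      using mem adj by (intro coset_context coset_move) (simp_all add: fp_words_simps)
    also have "\<dots> = coset ((a @ b) @ [(v, g), (v, h)] @ c)" by simp
    also have "\<dots> = coset ((a @ b) @ [(v, g \<otimes>\<^bsub>G v\<^esub> h)] @ c)"
      using mem by (intro coset_rel fp_rel.mult) (simp_all add: fp_words_simps)
    finally show ?thesis
      using mem by (intro bexI[of _ "(a @ b) @ [(v, g \<otimes>\<^bsub>G v\<^esub> h)] @ c"]) (simp_all add: w_eq fp_words_simps)
  qed
qed

lemma reduced_word_exists:
  "w \<in> fp_words V G \<Longrightarrow> \<exists>w' \<in> fp_words V G. coset w' = coset w \<and> reduced_word (enc w')"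
proof (induction w rule: length_induct)
  case (1 w)
  show ?case
  proof (cases "reduced_word (enc w)")
    case False
    from shorter_word[OF 1(2) this] obtain w1
      where w1: "w1 \<in> fp_words V G" "length w1 < length w" "coset w1 = coset w"
      by (elim bexE conjE)
    from 1(1)[rule_format, OF w1(2,1)] obtain w'
      where "w' \<in> fp_words V G" "coset w' = coset w1" "reduced_word (enc w')"
      by (elim bexE conjE)
    then show ?thesis using w1(3) by (intro bexI[of _ w']) simp_all
  qed (use 1 in blast)
qed

text \<open>Modulo \<open>N\<close>, an element of the kernel is represented by a reduced word,
  which again lies in the kernel. A nonempty reduced word moves \<open>unit None\<close>, so this
  word is empty and the element lies in \<open>N\<close>.\<close>

lemma kernel_hom_rep: "kernel F GL hom_rep = N"
proof
  interpret \<Phi>: group_hom F GL hom_rep by (rule group_hom_rep)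
  have N: "subgroup N F" by (rule normal_imp_subgroup[OF normal_N])
  show "kernel F GL hom_rep \<subseteq> N"
  proof
    fix x assume "x \<in> kernel F GL hom_rep"
    then have x: "x \<in> carrier F" "hom_rep x = \<one>\<^bsub>GL\<^esub>" by (auto simp: kernel_def)
    obtain w where w: "w \<in> fp_words V G" "x = cls w" using x(1) by (rule free_product_carrierE)
    obtain w' where w': "w' \<in> fp_words V G" "coset w' = coset w" "reduced_word (enc w')"
      using reduced_word_exists[OF w(1)] by blast
    have cls: "cls w' \<in> carrier F" by (rule free_product_carrierI[OF w'(1)])
    have "cls w' \<in> coset w'" by (rule \<Phi>.G.rcos_self[OF cls N])
    then have "cls w' \<in> N #>\<^bsub>F\<^esub> x" using w' w by simp
    then obtain n where n: "n \<in> N" "cls w' = n \<otimes>\<^bsub>F\<^esub> x" by (auto simp: r_coset_def)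
    have "n \<in> carrier F" "hom_rep n = \<one>\<^bsub>GL\<^esub>"
      using n(1) normal_closure_subset_kernel by (auto simp: kernel_def)
    then have "hom_rep (cls w') = \<one>\<^bsub>GL\<^esub>" using n(2) x by simp
    then have "rep (enc w') = 1\<^sub>m dim" using w' by (simp add: hom_rep_cls general_linear_simps)
    then have "act (enc w') (unit None) = unit None" by (intro rep_eq_one_imp fst_enc w')
    then have "enc w' = []"
      using act_reduced_word[of "enc w'"] w' M_carrier by (fastforce simp: enc_def fp_words_def)
    then have "w' = []" by (simp add: enc_def)
    then have "n \<otimes>\<^bsub>F\<^esub> x = \<one>\<^bsub>F\<^esub>" using n(2) by (simp add: one_free_product)
    then have "x = inv\<^bsub>F\<^esub> n" using \<open>n \<in> carrier F\<close> x(1) by (metis \<Phi>.G.inv_equality \<Phi>.G.inv_inv \<Phi>.G.inv_closed)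
    then show "x \<in> N" using n(1) subgroup.m_inv_closed[OF N] by simp
  qed
qed (rule normal_closure_subset_kernel)

text \<open>The first isomorphism theorem for \<open>hom_rep\<close>, with the codomain cut down to
  the image to make it surjective.\<close>

lemma linear_graph_product: "linear_over (poly_vars (Suc r) :: 'a mpoly set) (graph_product V E G)"
proof -
  interpret \<Phi>: group_hom F GL hom_rep by (rule group_hom_rep)
  define H where "H = hom_rep ` carrier F"
  have H: "subgroup H GL" unfolding H_def by (rule \<Phi>.img_is_subgroup)
  interpret \<Psi>: group_hom F "GL\<lparr>carrier := H\<rparr>" hom_rep
    unfolding group_hom_def group_hom_axioms_def
    using \<Phi>.H.subgroup_imp_group[OF H] group_free_product by (auto simp: hom_def H_def)
  have "F Mod kernel F (GL\<lparr>carrier := H\<rparr>) hom_rep \<cong> GL\<lparr>carrier := H\<rparr>"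
    by (rule \<Psi>.FactGroup_iso) (simp add: H_def)
  moreover have "kernel F (GL\<lparr>carrier := H\<rparr>) hom_rep = N"
    using kernel_hom_rep by (simp add: kernel_def)
  ultimately have "graph_product V E G \<cong> GL\<lparr>carrier := H\<rparr>" by (simp add: graph_product_def)
  then show ?thesis unfolding linear_over_def using dim_ge_1 H by blast
qed

end

theorem theorem1:
  fixes V :: "'v set" and E :: "'v set set" and G :: "'v \<Rightarrow> ('g, 'm) monoid_scheme"
  assumes "finite V" and "simplicial_graph V E"
    and "\<And>v. v \<in> V \<Longrightarrow> group (G v)"
    and "\<And>v. v \<in> V \<Longrightarrow> linear_over (UNIV :: 'a::ring_1_no_zero_divisors set) (G v)"
  shows "\<exists>k. linear_over (poly_vars k :: ((nat \<Rightarrow>\<^sub>0 nat) \<Rightarrow>\<^sub>0 'a) set) (graph_product V E G)"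
proof -
  have "\<exists>n (M :: 'g \<Rightarrow> 'a mat). (\<forall>g\<in>carrier (G v). M g \<in> carrier_mat n n) \<and>
      (\<forall>g\<in>carrier (G v). \<forall>h\<in>carrier (G v). M (g \<otimes>\<^bsub>G v\<^esub> h) = M g * M h) \<and>
      M \<one>\<^bsub>G v\<^esub> = 1\<^sub>m n \<and> (\<forall>g\<in>carrier (G v). M g = 1\<^sub>m n \<longrightarrow> g = \<one>\<^bsub>G v\<^esub>)" if "v \<in> V" for v
    by (rule linear_over_faithful_rep[OF assms(4)[OF that] assms(3)[OF that]]) blast
  then obtain d and M :: "'v \<Rightarrow> 'g \<Rightarrow> 'a mat" where M: "\<And>v. v \<in> V \<Longrightarrow>
      (\<forall>g\<in>carrier (G v). M v g \<in> carrier_mat (d v) (d v)) \<and>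
      (\<forall>g\<in>carrier (G v). \<forall>h\<in>carrier (G v). M v (g \<otimes>\<^bsub>G v\<^esub> h) = M v g * M v h) \<and>
      M v \<one>\<^bsub>G v\<^esub> = 1\<^sub>m (d v) \<and> (\<forall>g\<in>carrier (G v). M v g = 1\<^sub>m (d v) \<longrightarrow> g = \<one>\<^bsub>G v\<^esub>)"
    by metis
  \<comment> \<open>The vertices receive the indices below \<open>card V\<close>, and
    \<open>card V\<close> itself is left for the remaining variable, so \<open>k\<close> is
    \<open>Suc (card V)\<close>.\<close>
  obtain idx where "bij_betw idx V {0..<card V}"
    using ex_bij_betw_finite_nat[OF assms(1)] by blast
  then have idx: "inj_on idx V" "\<And>v. v \<in> V \<Longrightarrow> idx v < card V"
    by (auto simp: bij_betw_def)
  interpret graph_product_rep V G E idx d "card V" M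
    by (intro graph_product_rep.intro group_family.intro vertex_rep.intro graph_product_rep_axioms.intro)
      (use assms idx M in \<open>auto simp: insert_commute\<close>)
  show ?thesis using linear_graph_product by blast
qed

end
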